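(* For every nonempty set $\mathcal{D}$ of discounting functions, the strict model-checking problem for $\mathrm{LTL}^{\mathrm{disc}\oplus}[\mathcal{D}]$ is undecidable: there is no algorithm that, given a finite Kripke structure $\mathcal{K}$, an $\mathrm{LTL}^{\mathrm{disc}\oplus}[\mathcal{D}]$ formula $\varphi$ and a threshold $v\in[0,1]$, decides whether $[\![\mathcal{K},\varphi]\!]>v$.
   Context: Let $AP$ be a finite set of atomic propositions. A computation is $\pi=\pi_0\pi_1\cdots\in(2^{AP})^\omega$, $\pi^i=\pi_i\pi_{i+1}\cdots$. A discounting function is a strictly decreasing $\eta:\mathbb{N}\to[0,1]$ with $\lim_{i\to\infty}\eta(i)=0$. $\mathrm{LTL}^{\mathrm{disc}\oplus}[\mathcal{D}]$ formulas: $\varphi ::= \mathtt{True}\mid p\mid\neg\varphi\mid\varphi\vee\varphi\mid\mathsf{X}\varphi\mid\varphi\,\mathsf{U}\,\varphi\mid\varphi\,\mathsf{U}_\eta\,\varphi\mid\varphi\oplus\varphi$ ($p\in AP$, $\eta\in\mathcal{D}$), with values: $[\![\pi,\mathtt{True}]\!]=1$; $[\![\pi,p]\!]=1$ if $p\in\pi_0$, else $0$; $[\![\pi,\neg\varphi]\!]=1-[\![\pi,\varphi]\!]$; $[\![\pi,\varphi\vee\psi]\!]=\max\{[\![\pi,\varphi]\!],[\![\pi,\psi]\!]\}$; $[\![\pi,\mathsf{X}\varphi]\!]=[\![\pi^1,\varphi]\!]$; $[\![\pi,\varphi\,\mathsf{U}\,\psi]\!]=\sup_{i\ge0}\min\{[\![\pi^i,\psi]\!],\min_{0\le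 j<i}[\![\pi^j,\varphi]\!]\}$; $[\![\pi,\varphi\,\mathsf{U}_\eta\,\psi]\!]=\sup_{i\ge0}\min\{\eta(i)[\![\pi^i,\psi]\!],\min_{0\le j<i}\eta(j)[\![\pi^j,\varphi]\!]\}$; $[\![\pi,\varphi\oplus\psi]\!]=\frac{[\![\pi,\varphi]\!]+[\![\pi,\psi]\!]}{2}$. A Kripke structure $\mathcal{K}=\langle AP,S,I,\rho,L\rangle$ has finite state set $S$, initial states $I\subseteq S$, total transition relation $\rho\subseteq S\times S$, labeling $L:S\to2^{AP}$; its computations are $L(s_0)L(s_1)\cdots$ for infinite paths with $s_0\in I$, $(s_i,s_{i+1})\in\rho$. $[\![\mathcal{K},\varphi]\!]=\inf\{[\![\pi,\varphi]\!]:\pi$ a computation of $\mathcal{K}\}$. *)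

theory Defs
  imports Complex_Main "HOL-Library.Nat_Bijection"
begin

definition discounting :: "(nat \<Rightarrow> real) \<Rightarrow> bool" where
  "discounting \<eta> \<longleftrightarrow>
     (\<forall>i. 0 \<le> \<eta> i \<and> \<eta> i \<le> 1) \<and>
     (\<forall>i j. i < j \<longrightarrow> \<eta> j < \<eta> i) \<and>
     \<eta> \<longlonglongrightarrow> 0"

section \<open>Syntax of LTL^{disc,avg}: discounting symbols are natural-number names\<close>

datatype ltl =
    LTrue
  | LProp nat
  | LNot ltl
  | LOr ltl ltl
  | LX ltl
  | LU ltl ltl
  | LUd nat ltl ltl   \<comment> \<open>\<open>LUd i a b\<close> is \<open>a U_\<eta> b\<close> with \<open>\<eta> = \<delta> i\<close>\<close>
  | LAvg ltl ltl

type_synonym computation = "nat \<Rightarrow> nat set"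

definition sfx :: "nat \<Rightarrow> computation \<Rightarrow> computation" where
  "sfx i \<pi> = (\<lambda>k. \<pi> (k + i))"

text \<open>\<open>\<delta> i\<close> is the discounting function named by symbol \<open>i\<close>.
  The minimum over the empty index range \<open>j < 0\<close> imposes no constraint.\<close>

primrec val :: "(nat \<Rightarrow> nat \<Rightarrow> real) \<Rightarrow> ltl \<Rightarrow> computation \<Rightarrow> real" where
  "val \<delta> LTrue \<pi> = 1"
| "val \<delta> (LProp p) \<pi> = (if p \<in> \<pi> 0 then 1 else 0)"
| "val \<delta> (LNot a) \<pi> = 1 - val \<delta> a \<pi>"
| "val \<delta> (LOr a b) \<pi> = max (val \<delta> a \<pi>) (val \<delta> b \<pi>)"
| "val \<delta> (LX a) \<pi> = val \<delta> a (sfx 1 \<pi>)"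
| "val \<delta> (LU a b) \<pi> =
     (SUP i. (if i = 0 then val \<delta> b (sfx i \<pi>)
              else min (val \<delta> b (sfx i \<pi>)) (Min ((\<lambda>j. val \<delta> a (sfx j \<pi>)) ` {..<i}))))"
| "val \<delta> (LUd e a b) \<pi> =
     (SUP i. (if i = 0 then \<delta> e i * val \<delta> b (sfx i \<pi>)
              else min (\<delta> e i * val \<delta> b (sfx i \<pi>))
                       (Min ((\<lambda>j. \<delta> e j * val \<delta> a (sfx j \<pi>)) ` {..<i}))))"
| "val \<delta> (LAvg a b) \<pi> = (val \<delta> a \<pi> + val \<delta> b \<pi>) / 2"

text \<open>A Kripke structure is \<open>(n, I, R, L)\<close>: states \<open>{0..<n}\<close>, initial states \<open>set I\<close>,
  transitions \<open>set R\<close>, and label of state \<open>s\<close> is \<open>set (L ! s)\<close> (a finite set of atoms).\<close>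

type_synonym kripke = "nat \<times> nat list \<times> (nat \<times> nat) list \<times> nat list list"

definition wf_kripke :: "kripke \<Rightarrow> bool" where
  "wf_kripke K = (case K of (n, I, R, L) \<Rightarrow>
     I \<noteq> [] \<and> (\<forall>s\<in>set I. s < n) \<and>
     (\<forall>(s, t)\<in>set R. s < n \<and> t < n) \<and>
     (\<forall>s<n. \<exists>t. (s, t) \<in> set R) \<and>
     length L = n)"

definition computations :: "kripke \<Rightarrow> computation set" where
  "computations K = (case K of (n, I, R, L) \<Rightarrow>
     {\<pi>. \<exists>s :: nat \<Rightarrow> nat. s 0 \<in> set I \<and> (\<forall>i. (s i, s (Suc i)) \<in> set R) \<and>
          \<pi> = (\<lambda>i. set (L ! s i))})"

definition kval :: "(nat \<Rightarrow> nat \<Rightarrow> real) \<Rightarrow> kripke \<Rightarrow> ltl \<Rightarrow> real" where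
  "kval \<delta> K \<phi> = (INF \<pi>\<in>computations K. val \<delta> \<phi> \<pi>)"

primrec enc_ltl :: "ltl \<Rightarrow> nat" where
  "enc_ltl LTrue = prod_encode (0, 0)"
| "enc_ltl (LProp p) = prod_encode (1, p)"
| "enc_ltl (LNot a) = prod_encode (2, enc_ltl a)"
| "enc_ltl (LOr a b) = prod_encode (3, prod_encode (enc_ltl a, enc_ltl b))"
| "enc_ltl (LX a) = prod_encode (4, enc_ltl a)"
| "enc_ltl (LU a b) = prod_encode (5, prod_encode (enc_ltl a, enc_ltl b))"
| "enc_ltl (LUd e a b) = prod_encode (6, prod_encode (e, prod_encode (enc_ltl a, enc_ltl b)))"
| "enc_ltl (LAvg a b) = prod_encode (7, prod_encode (enc_ltl a, enc_ltl b))"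

definition enc_kripke :: "kripke \<Rightarrow> nat" where
  "enc_kripke K = (case K of (n, I, R, L) \<Rightarrow>
     prod_encode (n, prod_encode (list_encode I,
       prod_encode (list_encode (map prod_encode R), list_encode (map list_encode L)))))"

definition enc_rat :: "rat \<Rightarrow> nat" where
  "enc_rat q = (case quotient_of q of (a, b) \<Rightarrow> prod_encode (int_encode a, int_encode b))"

definition enc_instance :: "kripke \<Rightarrow> ltl \<Rightarrow> rat \<Rightarrow> nat" where
  "enc_instance K \<phi> v = prod_encode (enc_kripke K, prod_encode (enc_ltl \<phi>, enc_rat v))"

datatype instr =
    Inc nat nat
  | Dec nat nat nat

type_synonym config = "nat \<times> (nat \<Rightarrow> nat)"

definition rm_step :: "instr list \<Rightarrow> config \<Rightarrow> config" where
  "rm_step prog c = (case c of (pc, regs) \<Rightarrow>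
     if length prog \<le> pc then (pc, regs) else
     (case prog ! pc of
        Inc r j \<Rightarrow> (j, regs(r := Suc (regs r)))
      | Dec r j k \<Rightarrow> (if 0 < regs r then (j, regs(r := regs r - 1)) else (k, regs))))"

definition rm_run :: "instr list \<Rightarrow> nat \<Rightarrow> config \<Rightarrow> config" where
  "rm_run prog t c = (rm_step prog ^^ t) c"

definition rm_halts_with :: "instr list \<Rightarrow> nat \<Rightarrow> nat \<Rightarrow> bool" where
  "rm_halts_with prog x out \<longleftrightarrow>
     (\<exists>t. length prog \<le> fst (rm_run prog t (0, (\<lambda>_. 0)(0 := x))) \<and>
          snd (rm_run prog t (0, (\<lambda>_. 0)(0 := x))) 0 = out)"

end

theory Submission
  imports Defs "HOL-Library.Infinite_Set"
begin

text \<open>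
  A configuration of a register machine is written as a sequence of blocks, one per register, the
  length of a block being the content of the register. The value of \<open>True U\<^sub>\<eta> b\<close> at the start of a
  block is \<open>\<eta>\<close> of its length, undiscounted until moves to the block of the same register in the next
  configuration, and averaging one value with the complement of the other gives \<open>1/2\<close> exactly when
  the two lengths are as they should be. So an infinite run yields a computation of value at most
  \<open>1/2\<close>. If the machine halts, every word contains an error. A word with small error must agree
  with the run step by step, and the finitely many expected lengths have discounts isolated from all
  others, so the infimum exceeds \<open>1/2\<close>.

  Undecidability is obtained by diagonalization. The formula is a part depending on the machine
  only, joined with a part fixing the initial contents \<open>x\<close>, \<open>y\<close> of two registers. Hence the code of
  the instance is an easily computed function of \<open>x\<close>, \<open>y\<close> and of the codes of the Kripke structure
  and the machine part. A machine that reads \<open>x\<close> and \<open>y\<close> also as these two codes, asks the alleged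
  decision procedure about the resulting instance and does the opposite is contradictory when
  started on its own codes; no universal machine and no coding of programs is needed.
\<close>

section \<open>Structured register programs\<close>

definition reach :: "instr list \<Rightarrow> config \<Rightarrow> config \<Rightarrow> bool" where
  "reach P c c' \<longleftrightarrow> (\<exists>t. rm_run P t c = c')"

lemma rm_run_0 [simp]: "rm_run P 0 c = c"
  by (simp add: rm_run_def)

lemma rm_run_Suc: "rm_run P (Suc t) c = rm_step P (rm_run P t c)"
  by (simp add: rm_run_def)

lemma rm_run_add: "rm_run P (s + t) c = rm_run P s (rm_run P t c)"
  by (simp add: rm_run_def funpow_add)

lemma reach_refl: "reach P c c"
  unfolding reach_def by (metis rm_run_0)

lemma reach_trans [trans]: "reach P a b \<Longrightarrow> reach P b c \<Longrightarrow> reach P a c"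
  unfolding reach_def by (metis rm_run_add)

lemma reach_step: "rm_step P a = b \<Longrightarrow> reach P a b"
  unfolding reach_def by (metis rm_run_0 rm_run_Suc)

lemma run_halted:
  assumes "length P \<le> fst (rm_run P t c)" "t \<le> t'"
  shows "rm_run P t' c = rm_run P t c"
  using assms(2)
proof (induction rule: dec_induct)
  case (step n)
  then show ?case using assms(1)
    by (cases "rm_run P t c") (simp add: rm_run_Suc rm_step_def)
qed simp

definition code_at :: "instr list \<Rightarrow> nat \<Rightarrow> instr list \<Rightarrow> bool" where
  "code_at P p xs \<longleftrightarrow> (\<exists>ys zs. P = ys @ xs @ zs \<and> length ys = p)"

lemma code_at_append:
  "code_at P p (xs @ ys) \<Longrightarrow> code_at P p xs \<and> code_at P (p + length xs) ys"
  unfolding code_at_def by (metis append_assoc length_append)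

lemma code_at_Cons:
  assumes "code_at P p (x # xs)"
  shows "p < length P" "P ! p = x" "code_at P (Suc p) xs"
proof -
  show "p < length P" "P ! p = x"
    using assms unfolding code_at_def by auto
  show "code_at P (Suc p) xs"
    using assms code_at_append[of P p "[x]" xs] by simp
qed

datatype com = Incr nat | Seq com com | Loop nat com

primrec csize :: "com \<Rightarrow> nat" where
  "csize (Incr r) = 1"
| "csize (Seq a b) = csize a + csize b"
| "csize (Loop r a) = Suc (csize a)"

text \<open>Each instruction names its successor, so a command is compiled relative to its own
  address and to the address where control continues; the body of a loop continues at the loop
  head, and no unconditional jump is needed.\<close>

primrec compile :: "com \<Rightarrow> nat \<Rightarrow> nat \<Rightarrow> instr list" where
  "compile (Incr r) p e = [Inc r e]"
| "compile (Seq a b) p e = compile a p (p + csize a) @ compile b (p + csize a) e"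
| "compile (Loop r a) p e = Dec r (Suc p) e # compile a (Suc p) p"

lemma length_compile [simp]: "length (compile c p e) = csize c"
  by (induction c arbitrary: p e) auto

inductive exec :: "com \<Rightarrow> (nat \<Rightarrow> nat) \<Rightarrow> (nat \<Rightarrow> nat) \<Rightarrow> bool" where
  exec_Incr: "exec (Incr r) s (s(r := Suc (s r)))"
| exec_Seq: "exec a s s' \<Longrightarrow> exec b s' s'' \<Longrightarrow> exec (Seq a b) s s''"
| exec_Loop0: "s r = 0 \<Longrightarrow> exec (Loop r a) s s"
| exec_LoopS: "0 < s r \<Longrightarrow> exec a (s(r := s r - 1)) s' \<Longrightarrow> exec (Loop r a) s' s''
    \<Longrightarrow> exec (Loop r a) s s''"

lemma exec_compile:
  "exec c s s' \<Longrightarrow> code_at P p (compile c p e) \<Longrightarrow> reach P (p, s) (e, s')"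
proof (induction arbitrary: p e rule: exec.induct)
  case (exec_Incr r s)
  then show ?case
    using code_at_Cons[of P p "Inc r e" "[]"]
    by (intro reach_step) (simp add: rm_step_def fun_eq_iff)
next
  case (exec_Seq a s s' b s'')
  then have "code_at P p (compile a p (p + csize a))"
    "code_at P (p + csize a) (compile b (p + csize a) e)"
    using code_at_append[of P p "compile a p (p + csize a)"] by auto
  then show ?case
    using exec_Seq.IH reach_trans by blast
next
  case (exec_Loop0 s r a)
  then show ?case
    using code_at_Cons[of P p "Dec r (Suc p) e" "compile a (Suc p) p"]
    by (intro reach_step) (simp add: rm_step_def)
next
  case (exec_LoopS s r a s' s'')
  from exec_LoopS.prems have code: "p < length P" "P ! p = Dec r (Suc p) e"
    "code_at P (Suc p) (compile a (Suc p) p)"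
    by (auto dest: code_at_Cons)
  have "reach P (p, s) (Suc p, s(r := s r - 1))"
    using exec_LoopS.hyps code by (intro reach_step) (auto simp: rm_step_def)
  also note exec_LoopS.IH(1)[OF code(3)]
  also note exec_LoopS.IH(2)[OF exec_LoopS.prems]
  finally show ?case .
qed

text \<open>The rules for \<open>exec\<close> yield the final state as a tower of updates; its
  equality with the intended state becomes a separate goal for the simplifier.\<close>

lemma exec_cong: "exec c s s' \<Longrightarrow> s' = s'' \<Longrightarrow> exec c s s''"
  by simp

subsection \<open>Pairing\<close>

abbreviation move :: "nat \<Rightarrow> nat \<Rightarrow> com" where
  "move r d \<equiv> Loop r (Incr d)"

abbreviation move2 :: "nat \<Rightarrow> nat \<Rightarrow> nat \<Rightarrow> com" where
  "move2 r d e \<equiv> Loop r (Seq (Incr d) (Incr e))"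

text \<open>Compiled commands are nonempty; a loop on the register \<open>t\<close>, assumed to be zero, serves as the
  command that does nothing.\<close>

primrec add_const :: "nat \<Rightarrow> nat \<Rightarrow> nat \<Rightarrow> com" where
  "add_const t r 0 = Loop t (Incr t)"
| "add_const t r (Suc n) = Seq (Incr r) (add_const t r n)"

lemma exec_move:
  assumes "r \<noteq> d"
  shows "exec (move r d) s (s(r := 0, d := s d + s r))"
proof (induction "s r" arbitrary: s)
  case 0
  show ?case using 0[symmetric] by (intro exec_cong[OF exec_Loop0]) auto
next
  case (Suc n)
  define s1 where "s1 = s(r := n, d := Suc (s d))"
  have 1: "exec (Incr d) (s(r := s r - 1)) s1"
    using Suc.hyps(2)[symmetric] assms by (intro exec_cong[OF exec_Incr]) (simp add: s1_def)
  have 2: "exec (move r d) s1 (s1(r := 0, d := s1 d + s1 r))"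
    using Suc.hyps(2)[symmetric] assms by (intro Suc.hyps(1)) (simp add: s1_def)
  show ?case
    using Suc.hyps(2)[symmetric] assms
    by (intro exec_cong[OF exec_LoopS[OF _ 1 2]]) (auto simp: s1_def)
qed

lemma exec_move2:
  assumes "distinct [r, d, e]"
  shows "exec (move2 r d e) s (s(r := 0, d := s d + s r, e := s e + s r))"
proof (induction "s r" arbitrary: s)
  case 0
  show ?case using 0[symmetric] by (intro exec_cong[OF exec_Loop0]) auto
next
  case (Suc n)
  define s1 where "s1 = s(r := n, d := Suc (s d), e := Suc (s e))"
  have 1: "exec (Seq (Incr d) (Incr e)) (s(r := s r - 1)) s1"
    using Suc.hyps(2)[symmetric] assms
    by (intro exec_cong[OF exec_Seq[OF exec_Incr exec_Incr]]) (auto simp: s1_def)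
  have 2: "exec (move2 r d e) s1 (s1(r := 0, d := s1 d + s1 r, e := s1 e + s1 r))"
    using Suc.hyps(2)[symmetric] assms by (intro Suc.hyps(1)) (simp add: s1_def)
  show ?case
    using Suc.hyps(2)[symmetric] assms
    by (intro exec_cong[OF exec_LoopS[OF _ 1 2]]) (auto simp: s1_def)
qed

lemma exec_add_const:
  assumes "r \<noteq> t" "s t = 0"
  shows "exec (add_const t r n) s (s(r := s r + n))"
  using assms(2)
proof (induction n arbitrary: s)
  case 0
  then show ?case by (auto intro!: exec_cong[OF exec_Loop0])
next
  case (Suc n)
  have "exec (add_const t r n) (s(r := Suc (s r)))
      ((s(r := Suc (s r)))(r := (s(r := Suc (s r))) r + n))"
    using Suc assms(1) by (intro Suc.IH) auto
  from exec_cong[OF exec_Seq[OF exec_Incr this]] show ?case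
    by (simp del: fun_upd_apply add: fun_upd_same)
qed

text \<open>A round entered with \<open>n + 1\<close> in \<open>b\<close> adds \<open>n + 1\<close>
  to \<open>a\<close>, one by \<open>Incr\<close> and \<open>n\<close> by \<open>move2\<close>, and
  \<open>move t b\<close> restores the \<open>n\<close>. All rounds together add
  \<open>(n + 1) + n + ... + 1\<close>.\<close>

definition add_triangle :: "nat \<Rightarrow> nat \<Rightarrow> nat \<Rightarrow> com" where
  "add_triangle b a t = Loop b (Seq (Incr a) (Seq (move2 b a t) (move t b)))"

lemma exec_add_triangle:
  assumes "distinct [a, b, t]" "s t = 0"
  shows "exec (add_triangle b a t) s (s(b := 0, a := s a + triangle (s b)))"
  using assms(2)
proof (induction "s b" arbitrary: s)
  case 0
  show ?case
    unfolding add_triangle_def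
    using 0(1)[symmetric] by (intro exec_cong[OF exec_Loop0]) auto
next
  case (Suc n)
  define s1 where "s1 = s(b := n, a := s a + Suc n)"
  have 1: "exec (Seq (Incr a) (Seq (move2 b a t) (move t b))) (s(b := s b - 1)) s1"
    using Suc.hyps(2)[symmetric] Suc.prems assms(1)
    by (intro exec_cong[OF exec_Seq[OF exec_Incr exec_Seq[OF exec_move2 exec_move]]])
      (auto simp: s1_def)
  have 2: "exec (add_triangle b a t) s1 (s1(b := 0, a := s1 a + triangle (s1 b)))"
    using Suc.hyps(2)[symmetric] Suc.prems assms by (intro Suc.hyps(1)) (auto simp: s1_def)
  show ?case
    unfolding add_triangle_def
    using Suc.hyps(2)[symmetric] assms
    by (intro exec_cong[OF exec_LoopS[OF _ 1 2[unfolded add_triangle_def]]])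
      (auto simp: s1_def)
qed

text \<open>Follows \<open>prod_encode (m, n) = triangle (m + n) + m\<close>: \<open>b\<close>
  receives the sum, \<open>a\<close> is restored from \<open>t\<close>, then the triangle of
  \<open>b\<close> is added to \<open>a\<close>.\<close>

definition pair :: "nat \<Rightarrow> nat \<Rightarrow> nat \<Rightarrow> com" where
  "pair a b t = Seq (move2 a b t) (Seq (move t a) (add_triangle b a t))"

lemma exec_pair:
  assumes "distinct [a, b, t]" "s t = 0"
  shows "exec (pair a b t) s (s(a := prod_encode (s a, s b), b := 0))"
  unfolding pair_def using assms
  by (intro exec_cong[OF exec_Seq[OF exec_move2 exec_Seq[OF exec_move exec_add_triangle]]])
    (auto simp: prod_encode_def fun_eq_iff add_ac)

subsection \<open>Computing the encoded instance\<close>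

text \<open>Register 2 accumulates the code of a formula; registers 3 and 4 are scratch.\<close>

definition pair_const :: "nat \<Rightarrow> com" where
  "pair_const c = Seq (add_const 4 3 c) (Seq (pair 3 2 4) (move 3 2))"

lemma exec_pair_const:
  assumes "s 3 = 0" "s 4 = 0"
  shows "exec (pair_const c) s (s(2 := prod_encode (c, s 2)))"
  unfolding pair_const_def using assms
  by (intro exec_cong[OF exec_Seq[OF exec_add_const exec_Seq[OF exec_pair exec_move]]])
    (auto simp: fun_eq_iff)

definition or_next_code :: "nat \<Rightarrow> nat \<Rightarrow> nat" where
  "or_next_code c e = prod_encode (3, prod_encode (c, prod_encode (4, e)))"

lemma enc_or_next: "enc_ltl (LOr a (LX b)) = or_next_code (enc_ltl a) (enc_ltl b)"
  by (simp add: or_next_code_def)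

definition or_next :: "nat \<Rightarrow> com" where
  "or_next c = Seq (pair_const 4) (Seq (pair_const c) (pair_const 3))"

lemma exec_or_next:
  assumes "s 3 = 0" "s 4 = 0"
  shows "exec (or_next c) s (s(2 := or_next_code c (s 2)))"
  unfolding or_next_def using assms
  by (intro exec_cong[OF exec_Seq[OF exec_pair_const
        exec_Seq[OF exec_pair_const exec_pair_const]]])
    (auto simp: fun_eq_iff or_next_code_def)

text \<open>The loop consumes \<open>r\<close>, so \<open>d\<close> collects a copy:
  \<open>x\<close> and \<open>y\<close> serve once as numbers of iterations and a second time as
  codes.\<close>

definition iterate_or_next :: "nat \<Rightarrow> nat \<Rightarrow> nat \<Rightarrow> com" where
  "iterate_or_next r d c = Loop r (Seq (or_next c) (Incr d))"

lemma exec_iterate_or_next: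
  assumes "s 3 = 0" "s 4 = 0" "distinct [r, d, 2, 3, 4]"
  shows "exec (iterate_or_next r d c) s
    (s(r := 0, d := s d + s r, 2 := (or_next_code c ^^ s r) (s 2)))"
  using assms(1,2)
proof (induction "s r" arbitrary: s)
  case 0
  show ?case
    unfolding iterate_or_next_def
    using 0(1)[symmetric] by (intro exec_cong[OF exec_Loop0]) auto
next
  case (Suc n)
  define s1 where "s1 = s(r := n, d := Suc (s d), 2 := or_next_code c (s 2))"
  have 1: "exec (Seq (or_next c) (Incr d)) (s(r := s r - 1)) s1"
    using Suc.hyps(2)[symmetric] Suc.prems assms(3)
    by (intro exec_cong[OF exec_Seq[OF exec_or_next exec_Incr]]) (auto simp: s1_def)
  have 2: "exec (iterate_or_next r d c) s1
    (s1(r := 0, d := s1 d + s1 r, 2 := (or_next_code c ^^ s1 r) (s1 2)))"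
    using Suc.hyps(2)[symmetric] Suc.prems assms(3)
    by (intro Suc.hyps(1)) (auto simp: s1_def)
  show ?case
    unfolding iterate_or_next_def
    using Suc.hyps(2)[symmetric] assms(3)
    by (intro exec_cong[OF exec_LoopS[OF _ 1 2[unfolded iterate_or_next_def]]])
      (auto simp: s1_def funpow_swap1)
qed

abbreviation not_prop_code :: "nat \<Rightarrow> nat" where
  "not_prop_code p \<equiv> enc_ltl (LNot (LProp p))"

text \<open>Registers 0 and 1 contain \<open>x\<close> and \<open>y\<close>. The formula code grows
  from the inside out, so \<open>y\<close> is treated first; registers 6 and 5 keep copies of
  \<open>y\<close> and \<open>x\<close>. The tag 3 of \<open>LOr\<close> joins the formula coded by
  \<open>y\<close> with the new one. The threshold code \<open>v\<close> is hardwired.\<close>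

definition builder :: "nat \<Rightarrow> com" where
  "builder v =
    Seq (add_const 4 2 (not_prop_code 3))
   (Seq (iterate_or_next 1 6 (not_prop_code 0))
   (Seq (or_next (not_prop_code 2))
   (Seq (iterate_or_next 0 5 (not_prop_code 0))
   (Seq (or_next (not_prop_code 1))
   (Seq (pair 6 2 4)
   (Seq (move 6 2)
   (Seq (pair_const 3)
   (Seq (add_const 4 3 v)
   (Seq (pair 2 3 4)
   (Seq (pair 5 2 4)
        (move 5 0)))))))))))"

text \<open>No machine is mentioned, so \<open>builder\<close> can be written before the machine
  that contains it; \<open>enc_start\<close> identifies the formula.\<close>

definition init_code :: "nat \<Rightarrow> nat \<Rightarrow> nat" where
  "init_code x y =
    or_next_code (not_prop_code 1)
     ((or_next_code (not_prop_code 0) ^^ x)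
       (or_next_code (not_prop_code 2)
         ((or_next_code (not_prop_code 0) ^^ y) (not_prop_code 3))))"

definition regfile :: "nat \<Rightarrow> nat \<Rightarrow> nat \<Rightarrow> nat \<Rightarrow> nat \<Rightarrow> nat \<Rightarrow> nat \<Rightarrow> nat \<Rightarrow> nat" where
  "regfile a b c d e f g =
    (\<lambda>_. 0)(0 := a, 1 := b, 2 := c, 3 := d, 4 := e, 5 := f, 6 := g)"

lemma regfile_lookup [simp]:
  "regfile a b c d e f g 0 = a" "regfile a b c d e f g (Suc 0) = b" "regfile a b c d e f g 2 = c"
  "regfile a b c d e f g 3 = d" "regfile a b c d e f g 4 = e" "regfile a b c d e f g 5 = f"
  "regfile a b c d e f g 6 = g"
  by (auto simp: regfile_def)

lemma regfile_update [simp]: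
  "(regfile a b c d e f g)(0 := x) = regfile x b c d e f g"
  "(regfile a b c d e f g)(Suc 0 := x) = regfile a x c d e f g"
  "(regfile a b c d e f g)(2 := x) = regfile a b x d e f g"
  "(regfile a b c d e f g)(3 := x) = regfile a b c x e f g"
  "(regfile a b c d e f g)(4 := x) = regfile a b c d x f g"
  "(regfile a b c d e f g)(5 := x) = regfile a b c d e x g"
  "(regfile a b c d e f g)(6 := x) = regfile a b c d e f x"
  by (auto simp: regfile_def fun_eq_iff)

lemma exec_builder:
  "exec (builder v) ((\<lambda>_. 0)(0 := x, 1 := y))
    ((\<lambda>_. 0)(0 := prod_encode (x, prod_encode
        (prod_encode (3, prod_encode (y, init_code x y)), v))))"
proof -
  define n0 n1 n2 n3 where "n0 = not_prop_code 0" and "n1 = not_prop_code 1"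
    and "n2 = not_prop_code 2" and "n3 = not_prop_code 3"
  note n = this
  define e1 where "e1 = (or_next_code n0 ^^ y) n3"
  define e2 where "e2 = or_next_code n2 e1"
  define e3 where "e3 = (or_next_code n0 ^^ x) e2"
  define e4 where "e4 = or_next_code n1 e3"
  define e5 where "e5 = prod_encode (y, e4)"
  define e6 where "e6 = prod_encode (3, e5)"
  define e7 where "e7 = prod_encode (e6, v)"
  define e8 where "e8 = prod_encode (x, e7)"
  note e = e1_def e2_def e3_def e4_def e5_def e6_def e7_def e8_def
  have 1: "exec (add_const 4 2 n3) (regfile x y 0 0 0 0 0) (regfile x y n3 0 0 0 0)"
    by (rule exec_cong[OF exec_add_const]) auto
  have 2: "exec (iterate_or_next 1 6 n0) (regfile x y n3 0 0 0 0) (regfile x 0 e1 0 0 0 y)"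
    by (rule exec_cong[OF exec_iterate_or_next]) (auto simp: e)
  have 3: "exec (or_next n2) (regfile x 0 e1 0 0 0 y) (regfile x 0 e2 0 0 0 y)"
    by (rule exec_cong[OF exec_or_next]) (auto simp: e)
  have 4: "exec (iterate_or_next 0 5 n0) (regfile x 0 e2 0 0 0 y) (regfile 0 0 e3 0 0 x y)"
    by (rule exec_cong[OF exec_iterate_or_next]) (auto simp: e)
  have 5: "exec (or_next n1) (regfile 0 0 e3 0 0 x y) (regfile 0 0 e4 0 0 x y)"
    by (rule exec_cong[OF exec_or_next]) (auto simp: e)
  have 6: "exec (pair 6 2 4) (regfile 0 0 e4 0 0 x y) (regfile 0 0 0 0 0 x e5)"
    by (rule exec_cong[OF exec_pair]) (auto simp: e)
  have 7: "exec (move 6 2) (regfile 0 0 0 0 0 x e5) (regfile 0 0 e5 0 0 x 0)"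
    by (rule exec_cong[OF exec_move]) auto
  have 8: "exec (pair_const 3) (regfile 0 0 e5 0 0 x 0) (regfile 0 0 e6 0 0 x 0)"
    by (rule exec_cong[OF exec_pair_const]) (auto simp: e)
  have 9: "exec (add_const 4 3 v) (regfile 0 0 e6 0 0 x 0) (regfile 0 0 e6 v 0 x 0)"
    by (rule exec_cong[OF exec_add_const]) auto
  have 10: "exec (pair 2 3 4) (regfile 0 0 e6 v 0 x 0) (regfile 0 0 e7 0 0 x 0)"
    by (rule exec_cong[OF exec_pair]) (auto simp: e)
  have 11: "exec (pair 5 2 4) (regfile 0 0 e7 0 0 x 0) (regfile 0 0 0 0 0 e8 0)"
    by (rule exec_cong[OF exec_pair]) (auto simp: e)
  have 12: "exec (move 5 0) (regfile 0 0 0 0 0 e8 0) (regfile e8 0 0 0 0 0 0)"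
    by (rule exec_cong[OF exec_move]) auto
  have "exec (builder v) (regfile x y 0 0 0 0 0) (regfile e8 0 0 0 0 0 0)"
    unfolding builder_def n[symmetric]
    by (rule exec_Seq 1 2 3 4 5 6 7 8 9 10 11 12)+
  moreover have "regfile x y 0 0 0 0 0 = (\<lambda>_. 0)(0 := x, 1 := y)"
    and "regfile e8 0 0 0 0 0 0 = (\<lambda>_. 0)(0 := e8)"
    by (auto simp: regfile_def fun_eq_iff)
  ultimately show ?thesis
    by (simp del: enc_ltl.simps fun_upd_apply add: e init_code_def n)
qed

subsection \<open>The diagonal machine\<close>

text \<open>A machine may halt by jumping to any address from its length on. All these targets
  become the one address after the relocated copy, where control continues.\<close>

definition retarget :: "nat \<Rightarrow> nat \<Rightarrow> nat \<Rightarrow> nat" where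
  "retarget b n j = b + min j n"

primrec relocate :: "nat \<Rightarrow> nat \<Rightarrow> instr \<Rightarrow> instr" where
  "relocate b n (Inc r j) = Inc r (retarget b n j)"
| "relocate b n (Dec r j k) = Dec r (retarget b n j) (retarget b n k)"

lemma reach_relocate:
  assumes "code_at P b (map (relocate b (length D)) D)"
  shows "reach P (b, s)
    (b + min (fst (rm_run D t (0, s))) (length D), snd (rm_run D t (0, s)))"
proof (induction t)
  case 0
  then show ?case by (simp add: reach_refl)
next
  case (Suc t)
  obtain p s' where ps: "rm_run D t (0, s) = (p, s')" by fastforce
  show ?case
  proof (cases "length D \<le> p")
    case True
    then show ?thesis using Suc ps by (simp add: rm_run_Suc rm_step_def)
  next
    case False
    then have P: "b + p < length P" "P ! (b + p) = relocate b (length D) (D ! p)"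
      using assms unfolding code_at_def by (auto simp: nth_append)
    have "reach P (b + p, s')
      (b + min (fst (rm_step D (p, s'))) (length D), snd (rm_step D (p, s')))"
      using P False by (intro reach_step) (auto simp: rm_step_def retarget_def split: instr.splits)
    moreover have "reach P (b, s) (b + p, s')"
      using Suc False ps by simp
    ultimately show ?thesis
      unfolding rm_run_Suc ps by (rule reach_trans[rotated])
  qed
qed

definition halts :: "instr list \<Rightarrow> config \<Rightarrow> bool" where
  "halts P c \<longleftrightarrow> (\<exists>t. length P \<le> fst (rm_run P t c))"

text \<open>At \<open>e\<close>, output zero jumps beyond the program, while a positive output
  enters an endless cycle of decrementing and incrementing register 0.\<close>

definition diagonal :: "instr list \<Rightarrow> nat \<Rightarrow> instr list" where
  "diagonal D v = (let b = csize (builder v); e = b + length D in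
     compile (builder v) 0 b @ map (relocate b (length D)) D @ [Dec 0 (Suc e) (Suc (Suc e)), Inc 0 e])"

lemma halts_diagonal_iff:
  assumes "rm_halts_with D (prod_encode (x, prod_encode
        (prod_encode (3, prod_encode (y, init_code x y)), v))) out"
  shows "halts (diagonal D v) (0, (\<lambda>_. 0)(0 := x, 1 := y)) \<longleftrightarrow> out = 0"
proof -
  define P where "P = diagonal D v"
  define b where "b = csize (builder v)"
  define e where "e = b + length D"
  define c where "c = (0::nat, (\<lambda>_. 0::nat)(0::nat := x, 1 := y))"
  have P: "P = compile (builder v) 0 b @ map (relocate b (length D)) D
      @ [Dec 0 (Suc e) (Suc (Suc e)), Inc 0 e]"
    by (simp add: P_def b_def e_def diagonal_def Let_def)
  have code1: "code_at P 0 (compile (builder v) 0 b)"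
    unfolding code_at_def P by (metis append_Nil list.size(3))
  have code2: "code_at P b (map (relocate b (length D)) D)"
    unfolding code_at_def P by (intro exI conjI, rule refl) (simp add: b_def)
  have len: "length P = Suc (Suc e)" by (simp add: P b_def e_def)
  have Pe: "P ! e = Dec 0 (Suc e) (Suc (Suc e))" "P ! Suc e = Inc 0 e"
    by (auto simp: P nth_append b_def e_def)
  define z where "z = (\<lambda>_. 0::nat)(0::nat := prod_encode (x, prod_encode
        (prod_encode (3, prod_encode (y, init_code x y)), v)))"
  obtain t where t: "length D \<le> fst (rm_run D t (0, z))" "snd (rm_run D t (0, z)) 0 = out"
    using assms by (auto simp: rm_halts_with_def z_def)
  obtain s where s: "snd (rm_run D t (0, z)) = s" by simp
  have "reach P c (b, z)"
    unfolding c_def z_def using exec_compile[OF exec_builder code1] .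
  also have "reach P (b, z) (e, s)"
    using reach_relocate[OF code2, of z t] t s by (simp add: e_def)
  finally obtain t0 where t0: "rm_run P t0 c = (e, s)" by (auto simp: reach_def)
  show ?thesis
  proof (cases "out = 0")
    case True
    then have "rm_run P (Suc t0) c = (Suc (Suc e), s)"
      using t0 Pe len t s by (simp add: rm_run_Suc rm_step_def)
    then have "halts P c" unfolding halts_def len by (intro exI[of _ "Suc t0"]) simp
    with True show ?thesis by (simp add: P_def c_def)
  next
    case False
    \<comment> \<open>From time \<open>t0\<close> on control alternates between the last two
      instructions: register 0 is positive again whenever \<open>e\<close> is reached.\<close>
    have inv: "\<exists>p s'. rm_run P (k + t0) c = (p, s') \<and> (p = e \<and> 0 < s' 0 \<or> p = Suc e)" for k
    proof (induction k)
      case 0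
      then show ?case using t0 False t s by auto
    next
      case (Suc k)
      then show ?case using Pe len by (auto simp: rm_run_Suc rm_step_def)
    qed
    have "\<not> halts P c"
    proof
      assume "halts P c"
      then obtain t' where "length P \<le> fst (rm_run P t' c)" by (auto simp: halts_def)
      \<comment> \<open>Halted configurations do not change, so a halt at \<open>t'\<close>, even
        before \<open>t0\<close>, persists to time \<open>t' + t0\<close>, to which
        \<open>inv\<close> applies.\<close>
      moreover from this have "rm_run P (t' + t0) c = rm_run P t' c"
        by (rule run_halted) simp
      ultimately show False using inv[of t'] len by auto
    qed
    with False show ?thesis by (simp add: P_def c_def)
  qed
qed

section \<open>Values of formulas along a computation\<close>

definition value_at :: "(nat \<Rightarrow> nat \<Rightarrow> real) \<Rightarrow> computation \<Rightarrow> ltl \<Rightarrow> nat \<Rightarrow> real" where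
  "value_at \<delta> \<pi> \<phi> i = val \<delta> \<phi> (sfx i \<pi>)"

lemma sfx_sfx [simp]: "sfx k (sfx i \<pi>) = sfx (i + k) \<pi>"
  by (auto simp: sfx_def add_ac)

lemma sfx_0 [simp]: "sfx i \<pi> 0 = \<pi> i"
  by (simp add: sfx_def)

lemma val_eq_value_at: "val \<delta> \<phi> \<pi> = value_at \<delta> \<pi> \<phi> 0"
  by (simp add: value_at_def sfx_def)

definition until_term :: "(nat \<Rightarrow> real) \<Rightarrow> (nat \<Rightarrow> real) \<Rightarrow> nat \<Rightarrow> real" where
  "until_term f g k = (if k = 0 then g k else min (g k) (Min (f ` {..<k})))"

lemma le_until_term_iff: "c \<le> until_term f g k \<longleftrightarrow> c \<le> g k \<and> (\<forall>j<k. c \<le> f j)"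
  by (cases "k = 0") (auto simp: until_term_def Min_ge_iff lessThan_empty_iff)

lemma until_term_le: "until_term f g k \<le> g k"
  and until_term_le_guard: "j < k \<Longrightarrow> until_term f g k \<le> f j"
  using le_until_term_iff[of "until_term f g k" f g k] by auto

lemma value_at_simps:
  "value_at \<delta> \<pi> LTrue i = 1"
  "value_at \<delta> \<pi> (LProp p) i = of_bool (p \<in> \<pi> i)"
  "value_at \<delta> \<pi> (LNot a) i = 1 - value_at \<delta> \<pi> a i"
  "value_at \<delta> \<pi> (LOr a b) i = max (value_at \<delta> \<pi> a i) (value_at \<delta> \<pi> b i)"
  "value_at \<delta> \<pi> (LX a) i = value_at \<delta> \<pi> a (Suc i)"
  "value_at \<delta> \<pi> (LU a b) i =
     (SUP k. until_term (\<lambda>j. value_at \<delta> \<pi> a (i + j)) (\<lambda>j. value_at \<delta> \<pi> b (i + j)) k)"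
  "value_at \<delta> \<pi> (LUd e a b) i =
     (SUP k. until_term (\<lambda>j. \<delta> e j * value_at \<delta> \<pi> a (i + j))
        (\<lambda>j. \<delta> e j * value_at \<delta> \<pi> b (i + j)) k)"
  "value_at \<delta> \<pi> (LAvg a b) i = (value_at \<delta> \<pi> a i + value_at \<delta> \<pi> b i) / 2"
  by (simp_all add: value_at_def until_term_def)

lemma SUP_until_term_bounds:
  assumes "\<And>k. 0 \<le> f k" "\<And>k. 0 \<le> g k" "\<And>k. g k \<le> 1"
  shows "0 \<le> (SUP k. until_term f g k) \<and> (SUP k. until_term f g k) \<le> 1"
proof -
  have upper: "until_term f g k \<le> 1" for k
    using until_term_le[of f g k] assms(3)[of k] by linarith
  then have "bdd_above (range (until_term f g))" by (intro bdd_aboveI[of _ 1]) auto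
  then have "until_term f g 0 \<le> (SUP k. until_term f g k)" by (rule cSUP_upper[rotated]) simp
  moreover have "0 \<le> until_term f g 0" using assms by (simp add: until_term_def)
  ultimately show ?thesis using upper by (auto intro!: cSUP_least)
qed

text \<open>Besides giving the range of truth values, this makes the suprema bounded, so that
  \<open>SUP\<close> on the reals has its intended meaning.\<close>

lemma value_at_bounds:
  assumes "\<And>e i. 0 \<le> \<delta> e i" "\<And>e i. \<delta> e i \<le> 1"
  shows "0 \<le> value_at \<delta> \<pi> \<phi> i \<and> value_at \<delta> \<pi> \<phi> i \<le> 1"
proof (induction \<phi> arbitrary: i)
  case (LU a b)
  then show ?case unfolding value_at_simps by (intro SUP_until_term_bounds) auto
next
  case (LUd e a b)
  then show ?case unfolding value_at_simps
    by (intro SUP_until_term_bounds) (use assms in \<open>auto intro: mult_le_one\<close>)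
next
  case (LOr a b)
  then show ?case unfolding value_at_simps by (auto simp: max_def)
next
  case (LAvg a b)
  show ?case using LAvg(1)[of i] LAvg(2)[of i] unfolding value_at_simps by auto
qed (auto simp: value_at_simps)

definition LAnd :: "ltl \<Rightarrow> ltl \<Rightarrow> ltl" where
  "LAnd a b = LNot (LOr (LNot a) (LNot b))"

lemma value_at_LAnd: "value_at \<delta> \<pi> (LAnd a b) i = min (value_at \<delta> \<pi> a i) (value_at \<delta> \<pi> b i)"
  by (simp add: LAnd_def value_at_simps)

definition LOrs :: "ltl list \<Rightarrow> ltl" where
  "LOrs as = foldr LOr as (LNot LTrue)"

lemma value_at_LOrs_le_iff:
  "0 \<le> c \<Longrightarrow> value_at \<delta> \<pi> (LOrs as) i \<le> c \<longleftrightarrow> (\<forall>a\<in>set as. value_at \<delta> \<pi> a i \<le> c)"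
  by (induction as) (auto simp: LOrs_def value_at_simps)

lemma value_at_LOrs_bool:
  assumes "\<And>a. a \<in> set as \<Longrightarrow> value_at \<delta> \<pi> a i = of_bool (P a)"
  shows "value_at \<delta> \<pi> (LOrs as) i = of_bool (\<exists>a\<in>set as. P a)"
  using assms by (induction as) (auto simp: LOrs_def value_at_simps)

text \<open>The average of one value and the complement of another is \<open>1/2\<close> exactly when the two
  values agree; this is how a formula tests the equality of two discounted distances.\<close>

definition differ :: "ltl \<Rightarrow> ltl \<Rightarrow> ltl" where
  "differ a b = LOr (LAvg a (LNot b)) (LAvg b (LNot a))"

lemma value_at_differ:
  "value_at \<delta> \<pi> (differ a b) i = 1/2 + \<bar>value_at \<delta> \<pi> a i - value_at \<delta> \<pi> b i\<bar> / 2"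
  by (auto simp: differ_def value_at_simps max_def abs_if field_simps)

section \<open>Isolated discounts and the values of until formulas\<close>

locale discounted =
  fixes \<delta> :: "nat \<Rightarrow> nat \<Rightarrow> real"
  assumes discounting: "discounting (\<delta> e)"
begin

abbreviation "eta \<equiv> \<delta> 0"

lemma bounds: "0 \<le> \<delta> e i" "\<delta> e i \<le> 1"
  using discounting[of e] by (auto simp: discounting_def)

lemma eta_strict: "i < j \<Longrightarrow> eta j < eta i"
  using discounting[of 0] by (auto simp: discounting_def)

lemmas value_bounds = value_at_bounds[of \<delta>, OF bounds]

text \<open>A threshold detecting any deviation from one of finitely many expected distances.\<close>

lemma eta_gap: "\<exists>\<epsilon>>0. \<forall>k\<le>n. \<forall>j. \<bar>eta k - eta j\<bar> \<le> \<epsilon> \<longrightarrow> j = k"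
proof (induction n)
  case 0
  have "j = 0" if "\<bar>eta 0 - eta j\<bar> \<le> (eta 0 - eta 1) / 2" for j
    using that eta_strict[of 0 1] eta_strict[of 1 j] by (cases "j > 1"; cases "j = 1") auto
  then show ?case using eta_strict[of 0 1] by (intro exI[of _ "(eta 0 - eta 1) / 2"]) auto
next
  case (Suc n)
  then obtain \<epsilon> where e: "\<epsilon> > 0" "\<And>k j. k \<le> n \<Longrightarrow> \<bar>eta k - eta j\<bar> \<le> \<epsilon> \<Longrightarrow> j = k" by blast
  define m where "m = Suc n"
  \<comment> \<open>By monotonicity the values nearest to \<open>eta m\<close> are those of its two
    neighbours; half the smaller gap stays strictly below both distances.\<close>
  define \<gamma> where "\<gamma> = min \<epsilon> (min (eta n - eta m) (eta m - eta (Suc m)) / 2)"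
  have pos: "eta n - eta m > 0" "eta m - eta (Suc m) > 0"
    using eta_strict[of n m] eta_strict[of m "Suc m"] by (auto simp: m_def)
  have "j = m" if "\<bar>eta m - eta j\<bar> \<le> \<gamma>" for j
  proof (rule ccontr)
    assume "j \<noteq> m"
    then have "eta j \<ge> eta n \<or> eta j \<le> eta (Suc m)"
      using eta_strict[of j n] eta_strict[of "Suc m" j]
      by (cases "j < n"; cases "j = n"; cases "j = Suc m") (auto simp: m_def)
    then show False using that pos by (auto simp: \<gamma>_def)
  qed
  moreover have "j = k" if "k \<le> n" "\<bar>eta k - eta j\<bar> \<le> \<gamma>" for k j
    using e(2)[OF that(1)] that(2) by (auto simp: \<gamma>_def)
  ultimately show ?case
    using e(1) pos by (intro exI[of _ \<gamma>]) (auto simp: \<gamma>_def m_def le_Suc_eq)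
qed

lemma eventually_le_iff:
  "value_at \<delta> \<pi> (LU LTrue b) i \<le> c \<longleftrightarrow> (\<forall>k. value_at \<delta> \<pi> b (i + k) \<le> c)"
proof -
  have trm: "until_term (\<lambda>j. value_at \<delta> \<pi> LTrue (i + j)) (\<lambda>j. value_at \<delta> \<pi> b (i + j)) k
      = value_at \<delta> \<pi> b (i + k)" for k
    using value_bounds by (intro antisym until_term_le) (simp add: le_until_term_iff value_at_simps)
  have "bdd_above (range (\<lambda>k. value_at \<delta> \<pi> b (i + k)))"
    using value_bounds by (intro bdd_aboveI[of _ 1]) auto
  then show ?thesis
    unfolding value_at_simps(6) trm by (simp add: cSUP_le_iff)
qed

lemma until_bool:
  assumes "\<And>j. value_at \<delta> \<pi> a j = of_bool (P j)" "\<And>j. value_at \<delta> \<pi> b j = of_bool (Q j)"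
  shows "value_at \<delta> \<pi> (LU a b) i = of_bool (\<exists>k. Q (i + k) \<and> (\<forall>j<k. P (i + j)))"
proof -
  let ?t = "until_term (\<lambda>j. value_at \<delta> \<pi> a (i + j)) (\<lambda>j. value_at \<delta> \<pi> b (i + j))"
  have trm: "?t k = of_bool (Q (i + k) \<and> (\<forall>j<k. P (i + j)))" for k
  proof (cases "Q (i + k) \<and> (\<forall>j<k. P (i + j))")
    case True
    then have "1 \<le> ?t k" by (simp add: le_until_term_iff assms)
    moreover have "?t k \<le> 1" using until_term_le[of _ _ k] by (rule order_trans) (simp add: assms)
    ultimately show ?thesis using True by simp
  next
    case False
    then have "?t k \<le> 0"
    proof (cases "Q (i + k)")
      case True
      with False obtain j where "j < k" "\<not> P (i + j)" by blast
      then have "value_at \<delta> \<pi> a (i + j) \<le> 0" by (simp add: assms)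
      with \<open>j < k\<close> show ?thesis by (rule order_trans[OF until_term_le_guard])
    next
      case Q: False
      then show ?thesis by (intro order_trans[OF until_term_le]) (simp add: assms)
    qed
    moreover have "0 \<le> ?t k" by (simp add: le_until_term_iff assms)
    ultimately show ?thesis using False by simp
  qed
  show ?thesis
  proof (cases "\<exists>k. Q (i + k) \<and> (\<forall>j<k. P (i + j))")
    case True
    then have "1 \<in> range ?t" unfolding trm by force
    then show ?thesis unfolding value_at_simps(6)
      using True by (intro trans[OF cSup_eq_maximum[of 1]]) (auto simp: trm)
  next
    case False
    then have "?t k = 0" for k unfolding trm by simp
    then show ?thesis unfolding value_at_simps(6) using False by simp
  qed
qed

text \<open>The term at \<open>d\<close> attains the supremum: before \<open>d\<close> the conjunct
  \<open>q\<close> is 0, and for later terms the guard at \<open>d\<close> is 0. Thus a value is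
  carried over any distance without discount.\<close>

lemma until_first:
  assumes "\<And>j. value_at \<delta> \<pi> q j = of_bool (Q j)" "Q (i + d)" "\<And>j. j < d \<Longrightarrow> \<not> Q (i + j)"
  shows "value_at \<delta> \<pi> (LU (LNot q) (LAnd q a)) i = value_at \<delta> \<pi> a (i + d)"
proof -
  let ?f = "\<lambda>j. value_at \<delta> \<pi> (LNot q) (i + j)"
  let ?g = "\<lambda>j. value_at \<delta> \<pi> (LAnd q a) (i + j)"
  note v = value_bounds[of \<pi> a]
  have "until_term ?f ?g d = value_at \<delta> \<pi> a (i + d)"
  proof (rule antisym)
    show "until_term ?f ?g d \<le> value_at \<delta> \<pi> a (i + d)"
      by (rule order_trans[OF until_term_le]) (simp add: value_at_LAnd)
    show "value_at \<delta> \<pi> a (i + d) \<le> until_term ?f ?g d"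
      using v assms by (auto simp: le_until_term_iff value_at_LAnd value_at_simps)
  qed
  moreover have "until_term ?f ?g k \<le> value_at \<delta> \<pi> a (i + d)" for k
  proof -
    consider "k < d" | "k = d" | "d < k" by linarith
    then show ?thesis
    proof cases
      case 1
      then show ?thesis
        using v assms by (intro order_trans[OF until_term_le]) (auto simp: value_at_LAnd)
    next
      case 2
      then show ?thesis by (intro order_trans[OF until_term_le]) (simp add: value_at_LAnd)
    next
      case 3
      then show ?thesis
        using v assms by (intro order_trans[OF until_term_le_guard]) (auto simp: value_at_simps)
    qed
  qed
  ultimately show ?thesis
    unfolding value_at_simps(6) by (intro cSup_eq_maximum) (auto intro: range_eqI[of _ _ d])
qed

text \<open>The guard is discounted too, but its factors come before \<open>d\<close> and so exceed
  \<open>eta d\<close>. Later hits of \<open>q\<close> are worth less because \<open>eta\<close>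
  decreases.\<close>

lemma discounted_first:
  assumes "\<And>j. value_at \<delta> \<pi> q j = of_bool (Q j)" "Q (i + d)" "\<And>j. j < d \<Longrightarrow> \<not> Q (i + j)"
  shows "value_at \<delta> \<pi> (LUd 0 LTrue q) i = eta d"
proof -
  let ?f = "\<lambda>j. eta j * value_at \<delta> \<pi> LTrue (i + j)"
  let ?g = "\<lambda>j. eta j * value_at \<delta> \<pi> q (i + j)"
  have "until_term ?f ?g d = eta d"
  proof (rule antisym)
    show "until_term ?f ?g d \<le> eta d"
      by (rule order_trans[OF until_term_le]) (simp add: assms)
    show "eta d \<le> until_term ?f ?g d"
      using assms eta_strict by (auto simp: le_until_term_iff value_at_simps intro: less_imp_le)
  qed
  moreover have "until_term ?f ?g k \<le> eta d" for k
  proof (cases "k < d")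
    case True
    then show ?thesis
      using assms bounds by (intro order_trans[OF until_term_le]) auto
  next
    case False
    then have "eta k \<le> eta d" using eta_strict[of d k] by (cases "k = d") auto
    then show ?thesis
      using bounds by (intro order_trans[OF until_term_le]) (auto simp: assms)
  qed
  ultimately show ?thesis
    unfolding value_at_simps(7) by (intro cSup_eq_maximum) (auto intro: range_eqI[of _ _ d])
qed

end

section \<open>Runs of a register machine as computations\<close>

primrec instr_reg :: "instr \<Rightarrow> nat" where
  "instr_reg (Inc r j) = r"
| "instr_reg (Dec r j k) = r"

definition block :: "(nat \<Rightarrow> nat) \<Rightarrow> nat \<Rightarrow> nat" where
  "block G q = G (Suc q) - G q - 1"

text \<open>A configuration with program counter \<open>l\<close> is written as one block per register, the block of
  register \<open>r\<close> being the separator \<open>letter l r\<close> followed by as many zeros as the register says.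
  Blocks are numbered through all configurations: block \<open>q\<close> belongs to register \<open>q mod R\<close> at time
  \<open>q div R\<close>.\<close>

locale machine = discounted +
  fixes M :: "instr list" and R :: nat
  assumes R: "3 \<le> R" and reg_less: "I \<in> set M \<Longrightarrow> instr_reg I < R"
begin

text \<open>The \<open>Suc\<close> reserves 0 for the filler of the blocks; for
  \<open>r < R\<close>, quotient and remainder of the predecessor by \<open>R\<close> recover
  \<open>l\<close> and \<open>r\<close>.\<close>

definition letter :: "nat \<Rightarrow> nat \<Rightarrow> nat" where
  "letter l r = Suc (l * R + r)"

abbreviation V :: "(nat \<Rightarrow> nat) \<Rightarrow> ltl \<Rightarrow> nat \<Rightarrow> real" where
  "V w \<equiv> value_at \<delta> (\<lambda>i. {w i})"

abbreviation zero :: ltl where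
  "zero \<equiv> LProp 0"

abbreviation sep :: "nat \<Rightarrow> nat \<Rightarrow> ltl" where
  "sep l r \<equiv> LProp (letter l r)"

definition col :: "nat \<Rightarrow> ltl" where
  "col r = LOrs (map (\<lambda>l. sep l r) [0..<length M])"

definition next_col :: "nat \<Rightarrow> ltl \<Rightarrow> ltl" where
  "next_col r a = LX (LU (LNot (col r)) (LAnd (col r) a))"

text \<open>At a separator of register \<open>r\<close>, its value is \<open>\<eta>\<close> at the successor of the block length.\<close>

definition block_val :: "nat \<Rightarrow> ltl" where
  "block_val r = LUd 0 LTrue (LAnd (LNot zero) (LNot (col r)))"

text \<open>At a separator \<open>block_val\<close> sees the block length plus one, under a further
  \<open>LX\<close> the length itself. With \<open>LX\<close> on both sides, only the second or only
  the first, the test is for a length kept, increased or decreased.\<close>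

definition keep :: "nat \<Rightarrow> ltl" where
  "keep r = differ (LX (block_val r)) (next_col r (LX (block_val r)))"

definition increase :: "nat \<Rightarrow> ltl" where
  "increase r = differ (block_val r) (next_col r (LX (block_val r)))"

definition decrease :: "nat \<Rightarrow> ltl" where
  "decrease r = differ (LX (block_val r)) (next_col r (block_val r))"

definition jump :: "nat \<Rightarrow> ltl" where
  "jump j = LNot (next_col 0 (sep j 0))"

text \<open>Values above 1/2 signal errors. The jump is tested once per configuration, at the block
  of the register that the instruction names. There \<open>LX zero\<close> tells whether the block
  is nonempty, and the branch that does not apply has value 0.\<close>

primrec check :: "instr \<Rightarrow> nat \<Rightarrow> ltl" where
  "check (Inc p j) r = (if r = p then LOr (jump j) (increase r) else keep r)"
| "check (Dec p j k) r = (if r = p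
     then LOr (LAnd (LX zero) (LOr (jump j) (decrease r)))
       (LAnd (LNot (LX zero)) (LOr (jump k) (keep r)))
     else keep r)"

text \<open>Value 1 signals that the zeros after a separator do not end in the separator due next.
  After the last register any program counter is accepted, since \<open>jump\<close> checks
  it.\<close>

definition order :: "nat \<Rightarrow> nat \<Rightarrow> ltl" where
  "order l r = LNot (LX (LU zero (if Suc r < R then sep l (Suc r) else col 0)))"

definition bad :: ltl where
  "bad = LOrs (map (\<lambda>(l, r). LAnd (sep l r) (LOr (order l r) (check (M ! l) r)))
     (List.product [0..<length M] [0..<R]))"

definition static :: ltl where
  "static = LOr (LU LTrue bad) (LOrs (map (\<lambda>r. next_col r (LX zero)) [2..<R]))"

text \<open>The only part depending on the input; its code does not depend on \<open>M\<close>, the letters 1, 2, 3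
  being the separators of the first three registers at program counter 0.\<close>

abbreviation zero_then :: "ltl \<Rightarrow> ltl" where
  "zero_then a \<equiv> LOr (LNot (LProp 0)) (LX a)"

definition start :: "nat \<Rightarrow> nat \<Rightarrow> ltl" where
  "start x y = LOr (LNot (LProp 1)) (LX ((zero_then ^^ x)
     (LOr (LNot (LProp 2)) (LX ((zero_then ^^ y) (LNot (LProp 3)))))))"

definition spec :: "nat \<Rightarrow> nat \<Rightarrow> ltl" where
  "spec x y = LOr static (start x y)"

lemma letter_eq_iff:
  assumes "r < R" "r' < R"
  shows "letter l r = letter l' r' \<longleftrightarrow> l = l' \<and> r = r'"
proof
  assume eq: "letter l r = letter l' r'"
  then have "(l * R + r) div R = (l' * R + r') div R" "(l * R + r) mod R = (l' * R + r') mod R"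
    by (simp_all add: letter_def)
  then show "l = l' \<and> r = r'" using assms by simp
qed auto

lemma V_sep: "V w (LProp p) i = of_bool (w i = p)"
  by (auto simp: value_at_simps)

lemma V_col: "V w (col r) i = of_bool (\<exists>l<length M. w i = letter l r)"
  unfolding col_def
  by (subst value_at_LOrs_bool[where P = "\<lambda>a. \<exists>l. a = sep l r \<and> w i = letter l r"])
    (auto simp: V_sep)

lemma V_order:
  "V w (order l r) i = of_bool (\<not> (\<exists>k. (if Suc r < R then w (Suc i + k) = letter l (Suc r)
       else \<exists>l'<length M. w (Suc i + k) = letter l' 0) \<and> (\<forall>j<k. w (Suc i + j) = 0)))"
proof -
  have "V w (LU zero (if Suc r < R then sep l (Suc r) else col 0)) (Suc i)
    = of_bool (\<exists>k. (if Suc r < R then w (Suc i + k) = letter l (Suc r)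
       else \<exists>l'<length M. w (Suc i + k) = letter l' 0) \<and> (\<forall>j<k. w (Suc i + j) = 0))"
    by (rule until_bool) (auto simp: V_sep V_col)
  then show ?thesis
    unfolding order_def value_at_simps(3,5) by (simp only: of_bool_not_iff)
qed

lemma V_zero_then:
  "(\<And>i. V w a i = of_bool (A i)) \<Longrightarrow>
    V w ((zero_then ^^ x) a) i = of_bool (\<not> ((\<forall>j<x. w (i + j) = 0) \<and> \<not> A (i + x)))"
proof (induction x arbitrary: i)
  case (Suc x)
  have "(\<forall>j<Suc x. w (i + j) = 0) \<longleftrightarrow> w i = 0 \<and> (\<forall>j<x. w (Suc i + j) = 0)"
    using All_less_Suc2[of x "\<lambda>j. w (i + j) = 0"] by simp
  moreover have "V w ((zero_then ^^ Suc x) a) i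
      = max (of_bool (w i \<noteq> 0)) (V w ((zero_then ^^ x) a) (Suc i))"
    unfolding funpow.simps o_apply value_at_simps by simp
  ultimately show ?case
    using Suc by (simp only: Suc.IH) auto
qed simp

lemma V_start:
  "V w (start x y) 0 = of_bool (\<not> (w 0 = 1 \<and> (\<forall>j<x. w (Suc j) = 0) \<and> w (Suc x) = 2
     \<and> (\<forall>j<y. w (Suc (Suc (x + j))) = 0) \<and> w (Suc (Suc (x + y))) = 3))"
proof -
  have 1: "V w ((zero_then ^^ y) (LNot (LProp 3))) i
    = of_bool (\<not> ((\<forall>j<y. w (i + j) = 0) \<and> w (i + y) = 3))" for i
    by (subst V_zero_then[where A = "\<lambda>i. w i \<noteq> 3"]) (auto simp: value_at_simps)
  have 2: "V w (LOr (LNot (LProp 2)) (LX ((zero_then ^^ y) (LNot (LProp 3))))) i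
    = of_bool (\<not> (w i = 2 \<and> (\<forall>j<y. w (Suc i + j) = 0) \<and> w (Suc i + y) = 3))" for i
    unfolding value_at_simps(3-5) 1 by (auto simp: V_sep)
  show ?thesis
    unfolding start_def value_at_simps(3-5) V_zero_then[OF 2] by (auto simp: V_sep)
qed

lemma V_bad_le_iff:
  assumes "0 \<le> c" "c < 1"
  shows "V w bad i \<le> c \<longleftrightarrow> (\<forall>l<length M. \<forall>r<R. w i = letter l r \<longrightarrow>
    V w (order l r) i \<le> c \<and> V w (check (M ! l) r) i \<le> c)"
  unfolding bad_def value_at_LOrs_le_iff[OF assms(1)]
  using assms by (auto simp: value_at_LAnd value_at_simps(4) V_sep min_le_iff_disj)

subsection \<open>Words consisting of blocks\<close>

definition coded :: "(nat \<Rightarrow> nat) \<Rightarrow> (nat \<Rightarrow> nat) \<Rightarrow> (nat \<Rightarrow> nat) \<Rightarrow> bool" where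
  "coded w G f \<longleftrightarrow> strict_mono G \<and> G 0 = 0 \<and>
     (\<forall>q. f (q div R) < length M \<and> w (G q) = letter (f (q div R)) (q mod R)) \<and>
     (\<forall>i. i \<notin> range G \<longrightarrow> w i = 0)"

definition init_ok :: "nat \<Rightarrow> nat \<Rightarrow> (nat \<Rightarrow> nat) \<Rightarrow> (nat \<Rightarrow> nat) \<Rightarrow> bool" where
  "init_ok x y G f \<longleftrightarrow> f 0 = 0 \<and> (\<forall>r<R. block G r = ((\<lambda>_. 0)(0 := x, 1 := y)) r)"

text \<open>A bound on the formula controls lengths only through \<open>eta\<close> and up to an
  error, whence the tolerance. With tolerance 0 this is an exact machine step at one block,
  \<open>eta\<close> being injective.\<close>

definition step_ok :: "real \<Rightarrow> (nat \<Rightarrow> nat) \<Rightarrow> (nat \<Rightarrow> nat) \<Rightarrow> nat \<Rightarrow> bool" where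
  "step_ok \<epsilon> G f q = (let t = q div R; r = q mod R; m = block G q; m' = block G (q + R) in
     case M ! f t of
       Inc p j \<Rightarrow> if r = p then f (Suc t) = j \<and> \<bar>eta (Suc m) - eta m'\<bar> \<le> \<epsilon>
         else \<bar>eta m - eta m'\<bar> \<le> \<epsilon>
     | Dec p j k \<Rightarrow> if r = p
         then (if 0 < m then f (Suc t) = j \<and> \<bar>eta m - eta (Suc m')\<bar> \<le> \<epsilon>
           else f (Suc t) = k \<and> \<bar>eta m - eta m'\<bar> \<le> \<epsilon>)
         else \<bar>eta m - eta m'\<bar> \<le> \<epsilon>)"

lemma step_ok_mono: "step_ok \<epsilon> G f q \<Longrightarrow> \<epsilon> \<le> \<epsilon>' \<Longrightarrow> step_ok \<epsilon>' G f q"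
  by (cases "M ! f (q div R)") (auto simp: step_ok_def Let_def split: if_splits)

context
  fixes w G f
  assumes coded: "coded w G f"
begin

lemma G_mono: "G p < G q \<longleftrightarrow> p < q" "G p \<le> G q \<longleftrightarrow> p \<le> q" "G p = G q \<longleftrightarrow> p = q"
  using coded by (auto simp: coded_def strict_mono_less strict_mono_less_eq strict_mono_eq)

lemma G_Suc: "G (Suc q) = G q + Suc (block G q)"
  using iffD2[OF G_mono(1) lessI[of q]] unfolding block_def by linarith

lemma w_G: "w (G q) = letter (f (q div R)) (q mod R)" and f_less: "f (q div R) < length M"
  using coded by (auto simp: coded_def)

lemma G_0: "G 0 = 0"
  using coded by (auto simp: coded_def)

lemma f_less': "f t < length M"
  using f_less[of "t * R"] R by simp

lemma w_eq_0_iff: "w i = 0 \<longleftrightarrow> i \<notin> range G"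
  using coded by (auto simp: coded_def letter_def)

lemma mod_less: "q mod R < R"
  using R by simp

lemma V_col_coded: "r < R \<Longrightarrow> V w (col r) i = of_bool (\<exists>q. i = G q \<and> q mod R = r)"
proof -
  assume r: "r < R"
  have "(\<exists>l<length M. w i = letter l r) \<longleftrightarrow> (\<exists>q. i = G q \<and> q mod R = r)"
  proof
    assume "\<exists>l<length M. w i = letter l r"
    then obtain l where l: "w i = letter l r" by blast
    then have "w i \<noteq> 0" by (simp add: letter_def)
    then obtain q where "i = G q" using w_eq_0_iff[of i] by auto
    moreover from this have "letter (f (q div R)) (q mod R) = letter l r" using l w_G[of q] by simp
    then have "q mod R = r" using letter_eq_iff[OF mod_less r] by blast
    ultimately show "\<exists>q. i = G q \<and> q mod R = r" by blast
  next
    assume "\<exists>q. i = G q \<and> q mod R = r"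
    then obtain q where "i = G q" "q mod R = r" by blast
    then show "\<exists>l<length M. w i = letter l r" using w_G[of q] f_less[of q] by blast
  qed
  then show ?thesis by (simp add: V_col)
qed

lemma gap: "j < block G q \<Longrightarrow> w (Suc (G q) + j) = 0"
proof -
  assume j: "j < block G q"
  have "Suc (G q) + j \<noteq> G p" for p
  proof
    assume p: "Suc (G q) + j = G p"
    then have "G q < G p" "G p < G (Suc q)" using j G_Suc[of q] by linarith+
    then show False unfolding G_mono by simp
  qed
  then show ?thesis unfolding w_eq_0_iff by (metis imageE)
qed

lemma V_zero: "V w zero i = of_bool (i \<notin> range G)"
  by (simp add: V_sep w_eq_0_iff)

lemma V_next_zero: "V w zero (Suc (G q)) = of_bool (0 < block G q)"
proof -
  have "Suc (G q) \<in> range G \<longleftrightarrow> block G q = 0"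
  proof
    assume "Suc (G q) \<in> range G"
    then obtain p where p: "Suc (G q) = G p" by blast
    have "G q < G p" using p by simp
    then have "G (Suc q) \<le> G p" unfolding G_mono by simp
    then show "block G q = 0" using p G_Suc[of q] by simp
  next
    assume "block G q = 0"
    then show "Suc (G q) \<in> range G" using G_Suc[of q] by (metis add_Suc_right add_0_right rangeI)
  qed
  then show ?thesis by (simp add: V_zero)
qed

lemma V_next_col:
  assumes "q < q'" "r < R" "q' mod R = r" "\<And>p. q < p \<Longrightarrow> p < q' \<Longrightarrow> p mod R \<noteq> r"
  shows "V w (next_col r a) (G q) = V w a (G q')"
proof -
  define d where "d = G q' - Suc (G q)"
  have d: "Suc (G q) + d = G q'" using iffD2[OF G_mono(1) assms(1)] by (simp add: d_def)
  have "V w (LU (LNot (col r)) (LAnd (col r) a)) (Suc (G q)) = V w a (Suc (G q) + d)"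
  proof (rule until_first[OF V_col_coded[OF assms(2)]])
    show "\<exists>p. Suc (G q) + d = G p \<and> p mod R = r" using d assms(3) by blast
    fix j assume "j < d"
    then have j: "G q < Suc (G q) + j" "Suc (G q) + j < G q'" using d by auto
    show "\<nexists>p. Suc (G q) + j = G p \<and> p mod R = r"
    proof
      assume "\<exists>p. Suc (G q) + j = G p \<and> p mod R = r"
      then obtain p where p: "Suc (G q) + j = G p" "p mod R = r" by blast
      show False using j p(2) assms(4)[of p] unfolding p(1) G_mono by simp
    qed
  qed
  then show ?thesis by (simp only: next_col_def value_at_simps(5) d)
qed

lemma V_next_same: "V w (next_col (q mod R) a) (G q) = V w a (G (q + R))"
proof (rule V_next_col)
  fix p assume p: "q < p" "p < q + R"
  show "p mod R \<noteq> q mod R"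
  proof
    assume "p mod R = q mod R"
    then have "R dvd p - q" using p(1) by (metis mod_eq_dvd_iff_nat less_imp_le)
    then show False using p by (auto dest: dvd_imp_le)
  qed
qed (use R in auto)

lemma V_jump: "V w (jump j) (G q) = of_bool (f (Suc (q div R)) \<noteq> j)"
proof -
  have "V w (next_col 0 (sep j 0)) (G q) = V w (sep j 0) (G (Suc (q div R) * R))"
  proof (rule V_next_col)
    show "q < Suc (q div R) * R"
      using R dividend_less_div_times[of R q] by simp
    fix p assume p: "q < p" "p < Suc (q div R) * R"
    show "p mod R \<noteq> 0"
    proof
      assume "p mod R = 0"
      then obtain k where k: "p = k * R" by (metis mod_0_imp_dvd dvd_def mult.commute)
      then have "k \<le> q div R" using p(2) unfolding k mult_less_cancel2 by simp
      then have "k * R \<le> q" using R by (simp add: less_eq_div_iff_mult_less_eq)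
      then show False using p(1) k by simp
    qed
  qed (use R in auto)
  also have "\<dots> = of_bool (f (Suc (q div R)) = j)"
    using R w_G[of "Suc (q div R) * R"] by (simp add: V_sep letter_eq_iff)
  finally show ?thesis by (simp add: jump_def value_at_simps(3))
qed

text \<open>The formula stops at the first separator of another register. Excluding the register's
  own separators lets the search start on one; the next separator belongs to another register since
  \<open>R\<close> exceeds 1.\<close>

lemma V_block_val:
  shows "V w (block_val (q mod R)) (G q) = eta (Suc (block G q))"
    and "V w (block_val (q mod R)) (Suc (G q)) = eta (block G q)"
proof -
  let ?Q = "\<lambda>i. i \<in> range G \<and> (\<nexists>p. i = G p \<and> p mod R = q mod R)"
  have Q: "V w (LAnd (LNot zero) (LNot (col (q mod R)))) i = of_bool (?Q i)" for i
    by (auto simp: value_at_LAnd value_at_simps(3) V_zero V_col_coded[OF mod_less])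
  have "Suc q mod R \<noteq> q mod R" using R by (simp add: mod_Suc)
  then have hit: "?Q (G (Suc q))" by (auto simp: G_mono)
  have miss: "\<not> ?Q i" if i: "G q \<le> i" "i < G (Suc q)" for i
  proof
    assume *: "?Q i"
    then obtain p where p: "i = G p" by blast
    then have "p = q" using i unfolding p G_mono by simp
    then show False using p * by blast
  qed
  show "V w (block_val (q mod R)) (G q) = eta (Suc (block G q))"
    unfolding block_val_def
    by (rule discounted_first[OF Q]) (use hit miss in \<open>auto simp: G_Suc\<close>)
  show "V w (block_val (q mod R)) (Suc (G q)) = eta (block G q)"
    unfolding block_val_def
    by (rule discounted_first[OF Q]) (use hit miss in \<open>auto simp: G_Suc\<close>)
qed

lemma V_keep: "V w (keep (q mod R)) (G q)
    = 1/2 + \<bar>eta (block G q) - eta (block G (q + R))\<bar> / 2"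
  and V_increase: "V w (increase (q mod R)) (G q)
    = 1/2 + \<bar>eta (Suc (block G q)) - eta (block G (q + R))\<bar> / 2"
  and V_decrease: "V w (decrease (q mod R)) (G q)
    = 1/2 + \<bar>eta (block G q) - eta (Suc (block G (q + R)))\<bar> / 2"
  using V_block_val[of q] V_block_val[of "q + R"]
  by (simp_all add: keep_def increase_def decrease_def value_at_differ V_next_same value_at_simps(5))

text \<open>Comparisons have value 1/2 plus half a difference, which turns the bound
  \<open>c\<close> into the tolerance \<open>2 * c - 1\<close>; Boolean errors have value 1 and are
  excluded by \<open>c < 1\<close>.\<close>

lemma V_check_le_iff:
  assumes "1/2 \<le> c" "c < 1"
  shows "V w (check (M ! f (q div R)) (q mod R)) (G q) \<le> c \<longleftrightarrow> step_ok (2 * c - 1) G f q"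
  using assms
  by (cases "M ! f (q div R)"; cases "0 < block G q")
    (auto simp: step_ok_def Let_def value_at_LAnd value_at_simps(3-5) V_jump V_keep V_increase
      V_decrease V_next_zero min_le_iff_disj)

lemma V_order_coded: "V w (order (f (q div R)) (q mod R)) (G q) = 0"
proof -
  have pos: "Suc (G q) + block G q = G (Suc q)" using G_Suc by simp
  have "if Suc (q mod R) < R then w (G (Suc q)) = letter (f (q div R)) (Suc (q mod R))
      else \<exists>l'<length M. w (G (Suc q)) = letter l' 0"
    using w_G[of "Suc q"] f_less[of "Suc q"] mod_less[of q] by (auto simp: mod_Suc div_Suc)
  then have "\<exists>k. (if Suc (q mod R) < R
        then w (Suc (G q) + k) = letter (f (q div R)) (Suc (q mod R))
        else \<exists>l'<length M. w (Suc (G q) + k) = letter l' 0) \<and> (\<forall>j<k. w (Suc (G q) + j) = 0)"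
    using gap unfolding pos[symmetric] by blast
  then show ?thesis
    by (simp only: V_order not_True_eq_False of_bool_eq)
qed

lemma V_bad_coded:
  assumes "1/2 \<le> c" "c < 1"
  shows "(\<forall>i. V w bad i \<le> c) \<longleftrightarrow> (\<forall>q. step_ok (2 * c - 1) G f q)"
proof -
  have c: "0 \<le> c" using assms by simp
  show ?thesis
  proof (intro iffI allI)
    fix q assume "\<forall>i. V w bad i \<le> c"
    then have "V w bad (G q) \<le> c" by blast
    then have "V w (check (M ! f (q div R)) (q mod R)) (G q) \<le> c"
      unfolding V_bad_le_iff[OF c assms(2)] using f_less mod_less w_G by blast
    then show "step_ok (2 * c - 1) G f q" using V_check_le_iff[OF assms] by blast
  next
    fix i assume *: "\<forall>q. step_ok (2 * c - 1) G f q"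
    show "V w bad i \<le> c"
      unfolding V_bad_le_iff[OF c assms(2)]
    proof (intro allI impI)
      fix l r assume "l < length M" and r: "r < R" and i: "w i = letter l r"
      then have "w i \<noteq> 0" by (simp add: letter_def)
      then obtain q where q: "i = G q" using w_eq_0_iff[of i] by auto
      then have "letter l r = letter (f (q div R)) (q mod R)" using i w_G[of q] by simp
      then have "l = f (q div R)" "r = q mod R"
        using letter_eq_iff[OF r mod_less] by blast+
      then show "V w (order l r) i \<le> c \<and> V w (check (M ! l) r) i \<le> c"
        using V_order_coded[of q] V_check_le_iff[OF assms, of q] * c q by simp
    qed
  qed
qed

lemma V_rest_zero:
  assumes "0 \<le> c" "c < 1"
  shows "V w (LOrs (map (\<lambda>r. next_col r (LX zero)) [2..<R])) 0 \<le> c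
    \<longleftrightarrow> (\<forall>r<R. 2 \<le> r \<longrightarrow> block G r = 0)"
proof -
  have "V w (next_col r (LX zero)) 0 = of_bool (0 < block G r)" if "r < R" "2 \<le> r" for r
    using that V_next_col[of 0 r r "LX zero"] by (simp add: G_0 value_at_simps(5) V_next_zero)
  then show ?thesis
    using assms unfolding value_at_LOrs_le_iff[OF assms(1)] by auto
qed

lemma V_start_coded:
  "V w (start x y) 0 = of_bool (\<not> (f 0 = 0 \<and> block G 0 = x \<and> block G 1 = y))"
proof -
  have w0: "w 0 = 1 \<longleftrightarrow> f 0 = 0"
    using w_G[of 0] G_0 R by (simp add: letter_def)
  have w1: "w (G 1) = 2" and w2: "w (G 2) = 3" if "f 0 = 0"
    using w_G[of 1] w_G[of 2] R that by (simp_all add: letter_def)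
  have len: "block G q = m" if "\<forall>j<m. w (Suc (G q) + j) = 0" "w (Suc (G q) + m) \<noteq> 0" for q m
  proof -
    have "Suc (G q) + block G q = G (Suc q)"
      using G_Suc by simp
    then have "w (Suc (G q) + block G q) \<noteq> 0"
      unfolding w_eq_0_iff by (metis rangeI)
    then show ?thesis using that gap by (metis linorder_neqE_nat)
  qed
  have "w 0 = 1 \<and> (\<forall>j<x. w (Suc j) = 0) \<and> w (Suc x) = 2
     \<and> (\<forall>j<y. w (Suc (Suc (x + j))) = 0) \<and> w (Suc (Suc (x + y))) = 3
     \<longleftrightarrow> f 0 = 0 \<and> block G 0 = x \<and> block G 1 = y" (is "?l \<longleftrightarrow> ?r")
  proof
    assume l: ?l
    have x: "block G 0 = x" using len[where q = 0 and m = x] l G_0 by simp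
    then have G1: "G 1 = Suc x" using G_Suc[of 0] G_0 by simp
    have "block G 1 = y" using len[where q = 1 and m = y] l G1 by simp
    then show ?r using l w0 x by simp
  next
    assume r: ?r
    then have G1: "G 1 = Suc x" using G_Suc[of 0] G_0 by simp
    have G2: "G 2 = Suc (Suc (x + y))" using G_Suc[of 1] r G1 by (simp add: numeral_2_eq_2)
    show ?l
      using r w0 w1 w2 gap[of _ 0] gap[of _ 1] unfolding G_0 G1 G2 by simp
  qed
  then show ?thesis unfolding V_start by simp
qed

text \<open>Taking \<open>c = 1/2\<close> gives tolerance 0, for the word of an infinite run; a
  slightly larger \<open>c\<close> gives a positive tolerance, for words to be refuted.\<close>

lemma V_spec_le_iff:
  assumes "1/2 \<le> c" "c < 1"
  shows "V w (spec x y) 0 \<le> c \<longleftrightarrow> init_ok x y G f \<and> (\<forall>q. step_ok (2 * c - 1) G f q)"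
proof -
  have "V w (LU LTrue bad) 0 \<le> c \<longleftrightarrow> (\<forall>q. step_ok (2 * c - 1) G f q)"
    unfolding eventually_le_iff by (simp add: V_bad_coded[OF assms])
  moreover have "init_ok x y G f \<longleftrightarrow> f 0 = 0 \<and> block G 0 = x \<and> block G 1 = y
      \<and> (\<forall>r<R. 2 \<le> r \<longrightarrow> block G r = 0)"
  proof -
    have "r = 0 \<or> r = 1 \<or> 2 \<le> r" for r :: nat by linarith
    then have "(\<forall>r<R. P r) \<longleftrightarrow> P 0 \<and> P 1 \<and> (\<forall>r<R. 2 \<le> r \<longrightarrow> P r)" for P
      using R by (metis One_nat_def Suc_le_lessD less_le_trans numeral_3_eq_3 zero_less_Suc Suc_lessD)
    from this[of "\<lambda>r. block G r = ((\<lambda>_. 0)(0 := x, 1 := y)) r"] show ?thesis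
      unfolding init_ok_def by auto
  qed
  ultimately show ?thesis
    using assms V_rest_zero[of c]
    by (simp add: spec_def static_def value_at_simps(4) V_start_coded) auto
qed

end

end

section \<open>Small values and runs of the machine\<close>

context machine
begin

lemma letter_exists:
  assumes "0 < v" "v \<le> length M * R"
  obtains l r where "l < length M" "r < R" "v = letter l r"
proof (rule that)
  show "(v - 1) div R < length M"
    using assms R by (intro less_mult_imp_div_less) simp
  show "(v - 1) mod R < R" using R by simp
  show "v = letter ((v - 1) div R) ((v - 1) mod R)"
    using assms by (simp add: letter_def)
qed

text \<open>Order errors have value 1, so a bound below 1 forbids them: starting from letter 1, each
  separator is followed, after finitely many zeros, by one that is due next.\<close>

lemma coded_exists:
  assumes w: "\<And>i. w i \<le> length M * R"
    and V: "V w (spec x y) 0 \<le> c" and c: "0 \<le> c" "c < 1"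
  shows "\<exists>G f. coded w G f"
proof -
  have "V w (start x y) 0 \<le> c" and bad: "V w bad i \<le> c" for i
    using V eventually_le_iff[of _ bad 0 c] by (auto simp: spec_def static_def value_at_simps(4))
  then have "w 0 = 1" using c unfolding V_start by (auto split: if_splits simp: of_bool_def)
  then have w0: "w 0 = letter 0 0" by (simp add: letter_def)
  have step: "\<exists>k. (if Suc r < R then w (Suc i + k) = letter l (Suc r)
       else \<exists>l'<length M. w (Suc i + k) = letter l' 0) \<and> (\<forall>j<k. w (Suc i + j) = 0)"
    if "l < length M" "r < R" "w i = letter l r" for i l r
  proof -
    have "V w (order l r) i \<le> c" using bad[of i] that unfolding V_bad_le_iff[OF c] by blast
    then show ?thesis unfolding V_order using c(2) by (auto split: if_splits simp: of_bool_def)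
  qed
  define S where "S = {i. w i \<noteq> 0}"
  have unbounded: "\<exists>i'>i. i' \<in> S" if i: "i \<in> S" for i
  proof -
    obtain l r where lr: "l < length M" "r < R" "w i = letter l r"
      using letter_exists[of "w i"] w i by (auto simp: S_def)
    obtain k where "if Suc r < R then w (Suc i + k) = letter l (Suc r)
       else \<exists>l'<length M. w (Suc i + k) = letter l' 0" using step[OF lr] by blast
    then have "Suc i + k \<in> S" by (auto simp: S_def letter_def split: if_splits)
    then show ?thesis by (intro exI[of _ "Suc i + k"]) simp
  qed
  have "\<exists>n>m. n \<in> S" for m
  proof (induction m)
    case 0
    then show ?case using unbounded[of 0] w0 by (simp add: S_def letter_def)
  next
    case (Suc m)
    then show ?case using unbounded by (metis Suc_lessI)
  qed
  then have inf: "infinite S" by (simp add: infinite_nat_iff_unbounded)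
  define G where "G = enumerate S"
  have mono: "strict_mono G" unfolding G_def using inf by (rule strict_mono_enumerate)
  have range: "range G = S" unfolding G_def using inf by (rule range_enumerate)
  have G0: "G 0 = 0" using w0 by (simp add: G_def enumerate_0 S_def letter_def Least_eq_0)
  have G_Suc: "G (Suc q) = Suc (G q) + k"
    if "\<forall>j<k. w (Suc (G q) + j) = 0" "w (Suc (G q) + k) \<noteq> 0" for q k
    unfolding G_def enumerate_Suc''[OF inf]
  proof (rule Least_equality)
    show "Suc (enumerate S q) + k \<in> S \<and> enumerate S q < Suc (enumerate S q) + k"
      using that by (simp add: S_def G_def)
    fix s assume s: "s \<in> S \<and> enumerate S q < s"
    show "Suc (enumerate S q) + k \<le> s"
    proof (rule ccontr)
      assume "\<not> Suc (enumerate S q) + k \<le> s"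
      then obtain j where "s = Suc (G q) + j" "j < k"
        using s less_imp_add_positive[of "G q" s] unfolding G_def
        by (metis Suc_leI add_less_cancel_left le_Suc_ex not_le)
      then show False using that s by (auto simp: S_def)
    qed
  qed
  have next_sep: "if Suc r < R then w (G (Suc q)) = letter l (Suc r)
      else \<exists>l'<length M. w (G (Suc q)) = letter l' 0"
    if lr: "l < length M" "r < R" "w (G q) = letter l r" for q l r
  proof -
    obtain k where k: "if Suc r < R then w (Suc (G q) + k) = letter l (Suc r)
       else \<exists>l'<length M. w (Suc (G q) + k) = letter l' 0" "\<forall>j<k. w (Suc (G q) + j) = 0"
      using step[OF lr] by blast
    then have nz: "w (Suc (G q) + k) \<noteq> 0" by (auto simp: letter_def split: if_splits)
    show ?thesis using k(1) unfolding G_Suc[OF k(2) nz] .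
  qed
  have "0 < length M" using w[of 0] w0 by (auto simp: letter_def)
  have sep: "\<exists>l<length M. w (G q) = letter l (q mod R)" for q
  proof (induction q)
    case 0
    then show ?case using w0 G0 \<open>0 < length M\<close> by auto
  next
    case (Suc q)
    then obtain l where l: "l < length M" "w (G q) = letter l (q mod R)" by blast
    moreover have r: "q mod R < R" using R by simp
    ultimately show ?case
      using next_sep[of l "q mod R" q] by (auto simp: mod_Suc split: if_splits)
  qed
  \<comment> \<open>The program counter of a configuration is read off its first separator; the
    order condition propagates it to the other registers.\<close>
  have "\<exists>l<length M. w (G (t * R)) = letter l 0" for t
    using sep[of "t * R"] by simp
  then obtain f where f: "\<And>t. f t < length M" "\<And>t. w (G (t * R)) = letter (f t) 0" by metis
  have sep_f: "w (G (t * R + r)) = letter (f t) r" if "r < R" for t r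
    using that
  proof (induction r)
    case (Suc r)
    then show ?case using next_sep[of "f t" r "t * R + r"] f(1)[of t] by simp
  qed (simp add: f)
  have "w (G q) = letter (f (q div R)) (q mod R)" for q
    using sep_f[of "q mod R" "q div R"] R by simp
  then have "coded w G f"
    using mono G0 f(1) range by (auto simp: coded_def S_def)
  then show ?thesis by blast
qed

definition run :: "nat \<Rightarrow> nat \<Rightarrow> nat \<Rightarrow> config" where
  "run x y t = rm_run M t (0, (\<lambda>_. 0)(0 := x, 1 := y))"

lemma instr_reg_nth: "l < length M \<Longrightarrow> instr_reg (M ! l) < R"
  using reg_less by simp

lemma not_halts_spec:
  assumes "\<not> halts M (0, (\<lambda>_. 0)(0 := x, 1 := y))"
  shows "\<exists>w. (\<forall>i. w i \<le> length M * R) \<and> V w (spec x y) 0 \<le> 1/2"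
proof -
  define f where "f t = fst (run x y t)" for t
  define m where "m t = snd (run x y t)" for t
  \<comment> \<open>Each block takes one letter more than the register content, so the separators
    sit at partial sums.\<close>
  define G where "G q = (\<Sum>p<q. Suc (m (p div R) (p mod R)))" for q
  define w where "w i = (if i \<in> range G
    then (let q = inv G i in letter (f (q div R)) (q mod R)) else 0)" for i
  have f: "f t < length M" for t
    using assms unfolding halts_def f_def run_def by (simp add: not_le)
  have mono: "strict_mono G" by (simp add: strict_mono_Suc_iff G_def)
  then have "inj G" by (rule strict_mono_imp_inj_on)
  then have wG: "w (G q) = letter (f (q div R)) (q mod R)" for q
    by (simp add: w_def Let_def)
  have coded: "coded w G f"
    unfolding coded_def using mono f wG by (auto simp: G_def w_def)
  have block: "block G q = m (q div R) (q mod R)" for q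
    by (simp add: block_def G_def)
  have small: "letter (f t) r \<le> length M * R" if "r < R" for t r
  proof -
    have "letter (f t) r \<le> Suc (f t) * R" using that by (simp add: letter_def)
    also have "\<dots> \<le> length M * R" using f[of t] by (intro mult_le_mono1) simp
    finally show ?thesis .
  qed
  have "w i \<le> length M * R" for i
    using small R by (simp add: w_def Let_def)
  moreover have "step_ok (2 * (1/2) - 1) G f q" for q
  proof -
    define t r where "t = q div R" and "r = q mod R"
    have next_block: "block G (q + R) = m (Suc t) r" and here: "block G q = m t r"
      using R by (simp_all add: block t_def r_def)
    have "(f (Suc t), m (Suc t)) = rm_step M (f t, m t)"
      by (simp add: f_def m_def run_def rm_run_Suc)
    then show ?thesis
      unfolding step_ok_def Let_def next_block here t_def[symmetric] r_def[symmetric]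
      using f[of t] by (cases "M ! f t") (auto simp: rm_step_def split: if_splits)
  qed
  moreover have "init_ok x y G f"
    by (auto simp: init_ok_def block f_def m_def run_def)
  ultimately show ?thesis
    using V_spec_le_iff[OF coded, of "1/2" x y] by (intro exI[of _ w]) simp
qed

text \<open>The tolerance depends on \<open>t\<close> but not on the word. Each step shrinks it
  below the gaps of \<open>eta\<close> around the finitely many lengths that can be compared, so an
  error within the tolerance must be no error.\<close>

lemma step_ok_forces_run:
  "\<exists>\<epsilon>>0. \<forall>G f. (\<forall>t. f t < length M) \<longrightarrow> init_ok x y G f \<longrightarrow> (\<forall>q. step_ok \<epsilon> G f q) \<longrightarrow>
    f t = fst (run x y t) \<and> (\<forall>r<R. block G (t * R + r) = snd (run x y t) r)"
proof (induction t)
  case 0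
  show ?case by (intro exI[of _ 1]) (auto simp: init_ok_def run_def)
next
  case (Suc t)
  obtain l m where lm: "run x y t = (l, m)" by fastforce
  obtain \<epsilon> where e: "\<epsilon> > 0" and IH: "\<And>G f. \<forall>t. f t < length M \<Longrightarrow> init_ok x y G f \<Longrightarrow>
      \<forall>q. step_ok \<epsilon> G f q \<Longrightarrow> f t = l \<and> (\<forall>r<R. block G (t * R + r) = m r)"
    using Suc unfolding lm by auto
  \<comment> \<open>The bound covers every \<open>m r\<close> and also \<open>Suc (m r)\<close>, the
    length compared when register \<open>r\<close> is incremented.\<close>
  obtain \<gamma> where g: "\<gamma> > 0"
    and gap: "\<And>k j. k \<le> Suc (\<Sum>r<R. m r) \<Longrightarrow> \<bar>eta k - eta j\<bar> \<le> \<gamma> \<Longrightarrow> j = k"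
    using eta_gap[of "Suc (\<Sum>r<R. m r)"] by blast
  have forced: "f (Suc t) = fst (run x y (Suc t)) \<and>
      (\<forall>r<R. block G (Suc t * R + r) = snd (run x y (Suc t)) r)"
    if f: "\<forall>t. f t < length M" and init: "init_ok x y G f"
      and ok: "\<forall>q. step_ok (min \<epsilon> \<gamma>) G f q" for G f
  proof -
    have weaken: "step_ok \<epsilon>' G f q" if "min \<epsilon> \<gamma> \<le> \<epsilon>'" for \<epsilon>' q
      using ok that step_ok_mono by blast
    have now: "f t = l" "\<And>r. r < R \<Longrightarrow> block G (t * R + r) = m r"
      using IH[OF f init] weaken[of \<epsilon>] by auto
    have l: "l < length M" using f now(1) by auto
    have small: "m r \<le> (\<Sum>r<R. m r)" if "r < R" for r
      using that by (intro member_le_sum) auto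
    have step: "run x y (Suc t) = rm_step M (l, m)"
      using lm by (simp add: run_def rm_run_Suc)
    \<comment> \<open>Only the block of the instruction's own register determines the next program
      counter; that register is below \<open>R\<close>, so such a block exists.\<close>
    have next_r: "f (Suc t) = fst (rm_step M (l, m)) \<or> r \<noteq> instr_reg (M ! l)"
      "block G (Suc t * R + r) = snd (rm_step M (l, m)) r" if r: "r < R" for r
    proof -
      define m' where "m' = block G (Suc t * R + r)"
      have *: "block G (t * R + r + R) = m'" by (simp add: m'_def add_ac)
      have **: "\<bar>eta (m r) - eta j\<bar> \<le> \<gamma> \<Longrightarrow> j = m r"
        "\<bar>eta (Suc (m r)) - eta j\<bar> \<le> \<gamma> \<Longrightarrow> j = Suc (m r)" for j
        using gap small[OF r] by auto
      have div_mod: "(t * R + r) div R = t" "(t * R + r) mod R = r" using r by simp_all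
      have ok: "step_ok \<gamma> G f (t * R + r)" using weaken by simp
      show "f (Suc t) = fst (rm_step M (l, m)) \<or> r \<noteq> instr_reg (M ! l)"
        using ok l unfolding step_ok_def Let_def div_mod now(1) now(2)[OF r] *
        by (cases "M ! l") (auto simp: rm_step_def split: if_splits)
      show "block G (Suc t * R + r) = snd (rm_step M (l, m)) r"
        using ok l **(1)[of m'] **(1)[of "Suc m'"] **(2)[of m']
        unfolding step_ok_def Let_def div_mod now(1) now(2)[OF r] * m'_def[symmetric]
        by (cases "M ! l") (auto simp: rm_step_def split: if_splits)
    qed
    show ?thesis
      unfolding step using next_r instr_reg_nth[OF l] by blast
  qed
  show ?case
  proof (intro exI[of _ "min \<epsilon> \<gamma>"] conjI allI impI)
    show "0 < min \<epsilon> \<gamma>" using e g by simp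
  qed (use forced in blast)+
qed

lemma halts_spec:
  assumes "halts M (0, (\<lambda>_. 0)(0 := x, 1 := y))"
  shows "\<exists>c>1/2. \<forall>w. (\<forall>i. w i \<le> length M * R) \<longrightarrow> c \<le> V w (spec x y) 0"
proof -
  obtain t where t: "length M \<le> fst (run x y t)"
    using assms by (auto simp: halts_def run_def)
  obtain \<epsilon> where e: "\<epsilon> > 0" and forced: "\<And>G f. \<forall>t. f t < length M \<Longrightarrow> init_ok x y G f \<Longrightarrow>
      \<forall>q. step_ok \<epsilon> G f q \<Longrightarrow> f t = fst (run x y t)"
    using step_ok_forces_run[of x y t] by blast
  \<comment> \<open>This makes \<open>2 * c - 1\<close> at most the forcing tolerance, and 3/4 keeps
    \<open>c\<close> below 1.\<close>
  define c where "c = min (1/2 + \<epsilon> / 2) (3/4)"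
  have c: "1/2 \<le> c" "c < 1" "1/2 < c" using e by (auto simp: c_def)
  have "c \<le> V w (spec x y) 0" if w: "\<And>i. w i \<le> length M * R" for w
  proof (rule ccontr)
    assume "\<not> c \<le> V w (spec x y) 0"
    then have V: "V w (spec x y) 0 \<le> c" by simp
    then obtain G f where coded: "coded w G f"
      using coded_exists[OF w V] c by auto
    then have ok: "init_ok x y G f" "\<forall>q. step_ok (2 * c - 1) G f q"
      using V_spec_le_iff[OF coded c(1,2)] V by blast+
    have "step_ok \<epsilon> G f q" for q
      using ok(2)[rule_format, of q] by (rule step_ok_mono) (simp add: c_def min_def)
    \<comment> \<open>A coded word always shows a program counter inside the program, whereas the
      run has left it at time \<open>t\<close>.\<close>
    then have "f t = fst (run x y t)" using forced f_less'[OF coded] ok(1) by blast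
    then show False using t f_less'[OF coded, of t] by simp
  qed
  then show ?thesis using c(3) by blast
qed

subsection \<open>The model-checking instance\<close>

text \<open>Every word over the letters is a computation; the formula does all the checking.\<close>

definition complete_kripke :: kripke where
  "complete_kripke = (let n = Suc (length M * R) in
     (n, [0..<n], List.product [0..<n] [0..<n], map (\<lambda>s. [s]) [0..<n]))"

lemma wf_complete_kripke: "wf_kripke complete_kripke"
  by (auto simp: wf_kripke_def complete_kripke_def Let_def)

lemma computations_complete_kripke:
  "computations complete_kripke = {(\<lambda>i. {w i}) | w. \<forall>i. w i \<le> length M * R}"
proof -
  define n where "n = Suc (length M * R)"
  have path: "s 0 \<in> set [0..<n] \<and> (\<forall>i. (s i, s (Suc i)) \<in> set (List.product [0..<n] [0..<n]))
      \<longleftrightarrow> (\<forall>i. s i < n)" for s :: "nat \<Rightarrow> nat"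
    by auto
  have label: "(\<lambda>i. set (map (\<lambda>s. [s]) [0..<n] ! s i)) = (\<lambda>i. {s i})" if "\<forall>i. s i < n"
    for s :: "nat \<Rightarrow> nat"
    using that by auto
  have "computations complete_kripke
      = {\<pi>. \<exists>s. (\<forall>i. s i < n) \<and> \<pi> = (\<lambda>i. set (map (\<lambda>s. [s]) [0..<n] ! s i))}"
    unfolding computations_def complete_kripke_def Let_def prod.case n_def[symmetric]
      conj_assoc[symmetric] path ..
  also have "\<dots> = {\<pi>. \<exists>s. (\<forall>i. s i < n) \<and> \<pi> = (\<lambda>i. {s i})}"
    by (intro Collect_cong ex_cong1 conj_cong refl) (subst label, auto)
  also have "\<dots> = {(\<lambda>i. {w i}) | w. \<forall>i. w i \<le> length M * R}"
    by (auto simp: n_def less_Suc_eq_le)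
  finally show ?thesis .
qed

lemma kval_complete_kripke_iff:
  "1/2 < kval \<delta> complete_kripke (spec x y) \<longleftrightarrow> halts M (0, (\<lambda>_. 0)(0 := x, 1 := y))"
proof
  assume less: "1/2 < kval \<delta> complete_kripke (spec x y)"
  show "halts M (0, (\<lambda>_. 0)(0 := x, 1 := y))"
  proof (rule ccontr)
    assume "\<not> halts M (0, (\<lambda>_. 0)(0 := x, 1 := y))"
    then obtain w where w: "\<forall>i. w i \<le> length M * R" "V w (spec x y) 0 \<le> 1/2"
      using not_halts_spec by blast
    have "bdd_below (val \<delta> (spec x y) ` computations complete_kripke)"
      using value_bounds by (intro bdd_belowI[of _ 0]) (auto simp: val_eq_value_at)
    then have "kval \<delta> complete_kripke (spec x y) \<le> val \<delta> (spec x y) (\<lambda>i. {w i})"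
      unfolding kval_def using w(1)
      by (intro cINF_lower) (auto simp: computations_complete_kripke)
    then show False using less w(2) by (simp add: val_eq_value_at)
  qed
next
  assume "halts M (0, (\<lambda>_. 0)(0 := x, 1 := y))"
  then obtain c where c: "1/2 < c"
    "\<And>w. \<forall>i. w i \<le> length M * R \<Longrightarrow> c \<le> V w (spec x y) 0" using halts_spec by blast
  have "c \<le> kval \<delta> complete_kripke (spec x y)"
    unfolding kval_def computations_complete_kripke
    using c(2) by (intro cINF_greatest) (auto simp: val_eq_value_at intro: exI[of _ "\<lambda>_. 0"])
  with c(1) show "1/2 < kval \<delta> complete_kripke (spec x y)" by simp
qed

lemma enc_zero_then:
  "enc_ltl ((zero_then ^^ n) a) = (or_next_code (not_prop_code 0) ^^ n) (enc_ltl a)"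
  by (induction n) (simp_all only: funpow.simps id_apply o_apply enc_or_next)

lemma enc_start: "enc_ltl (start x y) = init_code x y"
  by (simp only: start_def init_code_def enc_or_next enc_zero_then)

lemma enc_instance_spec:
  "enc_instance complete_kripke (spec x y) v = prod_encode (enc_kripke complete_kripke, prod_encode
     (prod_encode (3, prod_encode (enc_ltl static, init_code x y)), enc_rat v))"
  by (simp only: enc_instance_def spec_def enc_start enc_ltl.simps(4))

end

section \<open>The diagonal contradiction\<close>

theorem theorem6:
  fixes D :: "(nat \<Rightarrow> real) set" and \<delta> :: "nat \<Rightarrow> nat \<Rightarrow> real"
  assumes "D \<noteq> {}"
    and "\<forall>\<eta>\<in>D. discounting \<eta>"
    and "range \<delta> \<subseteq> D"
  shows "\<not> (\<exists>prog. \<forall>K \<phi> (v :: rat).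
            wf_kripke K \<and> 0 \<le> v \<and> v \<le> 1 \<longrightarrow>
            rm_halts_with prog (enc_instance K \<phi> v)
              (if kval \<delta> K \<phi> > real_of_rat v then 1 else 0))"
proof
  assume "\<exists>prog. \<forall>K \<phi> (v :: rat). wf_kripke K \<and> 0 \<le> v \<and> v \<le> 1 \<longrightarrow>
    rm_halts_with prog (enc_instance K \<phi> v) (if kval \<delta> K \<phi> > real_of_rat v then 1 else 0)"
  then obtain prog where prog: "\<And>K \<phi> (v :: rat). wf_kripke K \<Longrightarrow> 0 \<le> v \<Longrightarrow> v \<le> 1 \<Longrightarrow>
    rm_halts_with prog (enc_instance K \<phi> v) (if kval \<delta> K \<phi> > real_of_rat v then 1 else 0)"
    by blast
  \<comment> \<open>The machine depends only on the alleged procedure and the threshold, so the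
    Kripke structure and \<open>static\<close> can be built from it without circularity.\<close>
  define M where "M = diagonal prog (enc_rat (1/2))"
  define R where "R = 3 + (\<Sum>I\<leftarrow>M. instr_reg I)"
  have "instr_reg I < R" if "I \<in> set M" for I
    using that member_le_sum_list[of "instr_reg I" "map instr_reg M"] by (simp add: R_def)
  moreover have "discounting (\<delta> e)" for e
    using assms(2) range_subsetD[OF assms(3)] by blast
  ultimately interpret machine \<delta> M R
    by unfold_locales (auto simp: R_def)
  \<comment> \<open>On these inputs \<open>M\<close> computes the instance that asks whether this
    very run of \<open>M\<close> halts.\<close>
  define x where "x = enc_kripke complete_kripke"
  define y where "y = enc_ltl static"
  have "rm_halts_with prog (enc_instance complete_kripke (spec x y) (1/2))
      (if kval \<delta> complete_kripke (spec x y) > real_of_rat (1/2) then 1 else 0)"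
    by (intro prog wf_complete_kripke) auto
  moreover have "real_of_rat (1/2) = 1/2" by (simp add: of_rat_divide)
  ultimately have "rm_halts_with prog (enc_instance complete_kripke (spec x y) (1/2))
      (if halts M (0, (\<lambda>_. 0)(0 := x, 1 := y)) then 1 else 0)"
    by (simp only: kval_complete_kripke_iff)
  then show False
    using halts_diagonal_iff[of prog x y "enc_rat (1/2)"]
    unfolding enc_instance_spec x_def[symmetric] y_def[symmetric] M_def[symmetric]
    by (auto split: if_splits)
qed

end
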